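(* Let $X\subset\mathbb{C}^2$ be a reduced algebraic curve, let $\hat u\in\Delta^{\mathrm{reg}}$, and let $p\in X_{\mathrm{reg}}$ be a singular (critical) point of $D_{\hat u}|_{X_{\mathrm{reg}}}$. Then the Morse number at $p$ is $$m_p(\hat u)=\operatorname{mult}_p\bigl(X,\{D_{\hat u}=D_{\hat u}(p)\}\bigr)-1.$$
   Context: For $u=(u_1,u_2)\in\mathbb{C}^2$, $D_u(x,y)=(x-u_1)^2+(y-u_2)^2$. $X_{\mathrm{reg}}$ is the smooth part of $X$; a Morse point of $D_u$ is a nondegenerate critical point of $D_u|_{X_{\mathrm{reg}}}$. Let $\mathcal{E}_X\subset X\times\mathbb{C}^2$ be the closure of the set of pairs $(\mathbf{x},u)$ with $\mathbf{x}\in X_{\mathrm{reg}}$ a critical point of $D_u|_{X_{\mathrm{reg}}}$, let $\pi_2:\mathcal{E}_X\to\mathbb{C}^2$ be the projection to $u$, and let $\mathrm{EDdeg}(X)$ be its degree, i.e. the number of Morse points of $D_u$ for generic $u$. The strict ED discriminant $\Delta_{ED}(X)$ is the set of $u$ such that $\pi_2^{-1}(u)$ has cardinality (without multiplicities) different from $\mathrm{EDdeg}(X)$. $\Delta^{\mathrm{reg}}$ is the closure of the set of points $u\in\Delta_{ED}(X)$ such that $D_u$ has a degenerate critical point on $X_{\mathrm{reg}}$. The Morse number $m_p=m_p(\hat u)$ at $p\in X_{\mathrm{reg}}$ is the number of Morse points which abut (converge) to $p$ as $s\to0$ in a Morse deformation $D_{u(s)}$ with $u(0)=\hat u$. $\operatorname{mult}_p(X,\{D_{\hat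 u}=D_{\hat u}(p)\})$ is the intersection multiplicity at $p$ of $X$ with the curve $\{D_{\hat u}=D_{\hat u}(p)\}$.
   Formalization: The intersection multiplicity of X with {D_û = D_û(p)} at p is additionally assumed finite; otherwise the formula fails, e.g. X the circle x²+y²=1 with û=0, where the multiplicity is infinite but only finitely many Morse points abut to p. *)

theory Defs
  imports
    "HOL-Complex_Analysis.Complex_Analysis"
    "HOL-Computational_Algebra.Computational_Algebra"
    "HOL-Library.Extended_Nat"
begin

section \<open>Plane curves\<close>

text \<open>
  The ring C[x,y] is represented as \<open>complex poly poly\<close>: the outer variable is \<open>y\<close>, and the
  coefficients are polynomials in \<open>x\<close>. A reduced algebraic curve in the affine plane is the zero set
  of a nonconstant squarefree polynomial, which generates its ideal; we carry that polynomial around.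
\<close>

definition eval2 :: "complex poly poly \<Rightarrow> complex \<times> complex \<Rightarrow> complex" where
  "eval2 f p = poly (poly f [:snd p:]) (fst p)"

definition const2 :: "complex \<Rightarrow> complex poly poly" where
  "const2 c = [:[:c:]:]"

definition var_x :: "complex poly poly" where "var_x = [:[:0, 1:]:]"

definition var_y :: "complex poly poly" where "var_y = [:0, 1:]"

definition partial_x :: "complex poly poly \<Rightarrow> complex poly poly" where
  "partial_x f = map_poly pderiv f"

definition partial_y :: "complex poly poly \<Rightarrow> complex poly poly" where
  "partial_y f = pderiv f"

definition reduced_curve_equation :: "complex poly poly \<Rightarrow> bool" where
  "reduced_curve_equation f \<longleftrightarrow> squarefree f \<and> \<not> f dvd 1"

definition curve :: "complex poly poly \<Rightarrow> (complex \<times> complex) set" where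
  "curve f = {p. eval2 f p = 0}"

text \<open>The Jacobian criterion describes the smooth part because \<open>f\<close> is squarefree.\<close>

definition curve_reg :: "complex poly poly \<Rightarrow> (complex \<times> complex) set" where
  "curve_reg f = {p \<in> curve f. eval2 (partial_x f) p \<noteq> 0 \<or> eval2 (partial_y f) p \<noteq> 0}"

section \<open>The squared distance function and its critical points\<close>

definition sq_dist :: "complex \<times> complex \<Rightarrow> complex \<times> complex \<Rightarrow> complex" where
  "sq_dist u p = (fst p - fst u)\<^sup>2 + (snd p - snd u)\<^sup>2"

definition sq_dist_poly :: "complex \<times> complex \<Rightarrow> complex poly poly" where
  "sq_dist_poly u = (var_x - const2 (fst u))\<^sup>2 + (var_y - const2 (snd u))\<^sup>2"

lemma eval2_simps [simp]:
  "eval2 (f + g) p = eval2 f p + eval2 g p"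
  "eval2 (f - g) p = eval2 f p - eval2 g p"
  "eval2 (f * g) p = eval2 f p * eval2 g p"
  "eval2 (f ^ n) p = eval2 f p ^ n"
  "eval2 (const2 c) p = c"
  "eval2 var_x p = fst p"
  "eval2 var_y p = snd p"
  by (simp_all add: eval2_def const2_def var_x_def var_y_def)

lemma eval2_sq_dist_poly [simp]: "eval2 (sq_dist_poly u) p = sq_dist u p"
  by (simp add: sq_dist_poly_def sq_dist_def)

text \<open>
  A holomorphic immersion germ into the curve. At a smooth point \<open>p\<close> it is the inverse of a local
  coordinate of the curve centred at \<open>p\<close>, by the implicit function theorem.
\<close>

definition local_param ::
    "complex poly poly \<Rightarrow> complex \<times> complex \<Rightarrow> (complex \<Rightarrow> complex \<times> complex) \<Rightarrow> bool" where
  "local_param f p \<gamma> \<longleftrightarrow>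
     (\<exists>r>0. (\<lambda>t. fst (\<gamma> t)) holomorphic_on ball 0 r \<and> (\<lambda>t. snd (\<gamma> t)) holomorphic_on ball 0 r \<and>
            \<gamma> ` ball 0 r \<subseteq> curve f) \<and>
     \<gamma> 0 = p \<and>
     (deriv (\<lambda>t. fst (\<gamma> t)) 0 \<noteq> 0 \<or> deriv (\<lambda>t. snd (\<gamma> t)) 0 \<noteq> 0)"

definition critical_point ::
    "complex poly poly \<Rightarrow> complex \<times> complex \<Rightarrow> complex \<times> complex \<Rightarrow> bool" where
  "critical_point f u p \<longleftrightarrow> p \<in> curve_reg f \<and>
     (\<exists>\<gamma>. local_param f p \<gamma> \<and> deriv (\<lambda>t. sq_dist u (\<gamma> t)) 0 = 0)"

definition morse_point ::
    "complex poly poly \<Rightarrow> complex \<times> complex \<Rightarrow> complex \<times> complex \<Rightarrow> bool" where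
  "morse_point f u p \<longleftrightarrow> p \<in> curve_reg f \<and>
     (\<exists>\<gamma>. local_param f p \<gamma> \<and> deriv (\<lambda>t. sq_dist u (\<gamma> t)) 0 = 0 \<and>
          (deriv ^^ 2) (\<lambda>t. sq_dist u (\<gamma> t)) 0 \<noteq> 0)"

section \<open>Discriminants\<close>

text \<open>
  Below, closures are taken in the Euclidean topology; the sets involved are constructible, so these
  are also their Zariski closures.
\<close>

definition ED_incidence :: "complex poly poly \<Rightarrow> ((complex \<times> complex) \<times> (complex \<times> complex)) set" where
  "ED_incidence f = closure {(p, u). critical_point f u p}"

text \<open>Generic means: outside the zero set of some nonzero polynomial in \<open>u\<close>.\<close>

definition ED_degree :: "complex poly poly \<Rightarrow> nat" where
  "ED_degree f = (THE n. \<exists>h. h \<noteq> 0 \<and>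
     (\<forall>u. eval2 h u \<noteq> 0 \<longrightarrow> finite {p. morse_point f u p} \<and> card {p. morse_point f u p} = n))"

text \<open>The finiteness clause is needed since \<open>card\<close> is \<open>0\<close> on infinite fibres.\<close>

definition strict_ED_discriminant :: "complex poly poly \<Rightarrow> (complex \<times> complex) set" where
  "strict_ED_discriminant f =
     {u. \<not> (finite {p. (p, u) \<in> ED_incidence f} \<and> card {p. (p, u) \<in> ED_incidence f} = ED_degree f)}"

definition ED_discriminant_reg :: "complex poly poly \<Rightarrow> (complex \<times> complex) set" where
  "ED_discriminant_reg f =
     closure {u \<in> strict_ED_discriminant f. \<exists>p. critical_point f u p \<and> \<not> morse_point f u p}"

section \<open>Morse number\<close>

text \<open>
  The parameter \<open>s\<close> runs through a small complex disc and \<open>u\<close> is only required to be continuous.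
  This covers holomorphic families, and also real paths \<open>v\<close> on an interval starting at \<open>0\<close>, through
  \<open>u s = v \<bar>s\<bar>\<close>.
\<close>

definition morse_deformation ::
    "complex poly poly \<Rightarrow> complex \<times> complex \<Rightarrow> (complex \<Rightarrow> complex \<times> complex) \<Rightarrow> bool" where
  "morse_deformation f u0 u \<longleftrightarrow> u 0 = u0 \<and>
     (\<exists>e>0. continuous_on (ball 0 e) u \<and>
        (\<forall>s \<in> ball 0 e - {0}. \<forall>q. critical_point f (u s) q \<longrightarrow> morse_point f (u s) q))"

text \<open>
  Exactly \<open>m\<close> Morse points of \<open>D\<^bsub>u(s)\<^esub>\<close> converge to \<open>p\<close>: every sufficiently small ball around \<open>p\<close>
  contains exactly \<open>m\<close> of them once \<open>s \<noteq> 0\<close> is close enough to \<open>0\<close>.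
\<close>

definition morse_points_abut ::
    "complex poly poly \<Rightarrow> (complex \<Rightarrow> complex \<times> complex) \<Rightarrow> complex \<times> complex \<Rightarrow> nat \<Rightarrow> bool" where
  "morse_points_abut f u p m \<longleftrightarrow>
     (\<exists>r0>0. \<forall>r. 0 < r \<and> r \<le> r0 \<longrightarrow>
        (\<forall>\<^sub>F s in at 0. finite {q \<in> ball p r. morse_point f (u s) q} \<and>
                        card {q \<in> ball p r. morse_point f (u s) q} = m))"

text \<open>
  The description is proper only if Morse deformations exist and all of them give the same number.
\<close>

definition morse_number ::
    "complex poly poly \<Rightarrow> complex \<times> complex \<Rightarrow> complex \<times> complex \<Rightarrow> nat" where
  "morse_number f u0 p =
     (THE m. \<forall>u. morse_deformation f u0 u \<longrightarrow> morse_points_abut f u p m)"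

section \<open>Intersection multiplicity\<close>

definition local_ring :: "complex \<times> complex \<Rightarrow> complex poly poly fract set" where
  "local_ring p = {Fract a b | a b. eval2 b p \<noteq> 0}"

definition local_ideal ::
    "complex \<times> complex \<Rightarrow> complex poly poly \<Rightarrow> complex poly poly \<Rightarrow> complex poly poly fract set" where
  "local_ideal p f g = {a * to_fract f + b * to_fract g | a b. a \<in> local_ring p \<and> b \<in> local_ring p}"

text \<open>\<open>B\<close> represents a basis of the complex vector space \<open>local_ring p\<close> modulo \<open>local_ideal p f g\<close>.\<close>

definition local_quotient_basis ::
    "complex \<times> complex \<Rightarrow> complex poly poly \<Rightarrow> complex poly poly \<Rightarrow> complex poly poly fract set \<Rightarrow> bool"
  where
  "local_quotient_basis p f g B \<longleftrightarrow> finite B \<and> B \<subseteq> local_ring p \<and>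
     (\<forall>h \<in> local_ring p. \<exists>!c :: complex poly poly fract \<Rightarrow> complex.
        (\<forall>b. b \<notin> B \<longrightarrow> c b = 0) \<and>
        h - (\<Sum>b\<in>B. to_fract (const2 (c b)) * b) \<in> local_ideal p f g)"

text \<open>
  The dimension of that quotient. It is \<open>\<infinity>\<close> if there is no finite basis, that is, if the two curves
  share a component through \<open>p\<close>.
\<close>

definition intersection_multiplicity ::
    "complex \<times> complex \<Rightarrow> complex poly poly \<Rightarrow> complex poly poly \<Rightarrow> enat" where
  "intersection_multiplicity p f g = (INF B \<in> {B. local_quotient_basis p f g B}. enat (card B))"

end

theory Submission
  imports Defs
begin

text \<open>
  Near the smooth point \<open>p\<close> the curve is a graph over one of the coordinates, with parametrization
  \<open>\<gamma>\<close>. Let \<open>N\<close> be the vanishing order of \<open>D\<^bsub>u0\<^esub> \<circ> \<gamma> - D\<^bsub>u0\<^esub>(p)\<close> at \<open>0\<close>.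

  The local ring of the curve at \<open>p\<close> is a discrete valuation ring whose valuation is the vanishing
  order along \<open>\<gamma>\<close>, so the powers of the coordinate below \<open>N\<close> form a basis of the quotient by
  \<open>D\<^bsub>u0\<^esub> - D\<^bsub>u0\<^esub>(p)\<close>, and the intersection multiplicity is \<open>N\<close>.

  Critical points of \<open>D\<^bsub>u\<^esub>\<close> near \<open>p\<close> are zeros of \<open>(D\<^bsub>u\<^esub> \<circ> \<gamma>)'\<close>, and a critical point is Morse iff the
  zero is simple. For \<open>u = u0\<close> this derivative vanishes to order \<open>N - 1\<close> at \<open>0\<close>, so by Rouche's
  theorem any Morse deformation has exactly \<open>N - 1\<close> Morse points near \<open>p\<close>.

  A Morse deformation exists because on the complex line \<open>u0 + (s, 0)\<close> only countably many centres
  have a degenerate critical point, so some real ray of that line avoids all of them.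
\<close>

unbundle no vec_syntax

section \<open>Evaluation of bivariate polynomials and its differential\<close>

lemma eval2_pCons [simp]: "eval2 (pCons c F) p = poly c (fst p) + snd p * eval2 F p"
  by (simp add: eval2_def)

lemma eval2_0 [simp]: "eval2 0 p = 0" and eval2_1 [simp]: "eval2 1 p = 1"
  by (simp_all add: eval2_def)

lemma has_derivative_eval2:
  "(eval2 F has_derivative
     (\<lambda>d. eval2 (partial_x F) p * fst d + eval2 (partial_y F) p * snd d)) (at p)"
proof (induction F)
  case 0
  have "eval2 0 = (\<lambda>_. 0)" by auto
  then show ?case by (simp add: partial_x_def partial_y_def)
next
  case (pCons c F)
  have c: "((\<lambda>p. poly c (fst p)) has_derivative (\<lambda>d. poly (pderiv c) (fst p) * fst d)) (at p)"
    by (rule has_derivative_compose[where f = fst and g = "poly c"])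
      (simp_all add: bounded_linear_imp_has_derivative bounded_linear_fst
        poly_DERIV[unfolded has_field_derivative_def])
  have "eval2 (pCons c F) = (\<lambda>p. poly c (fst p) + snd p * eval2 F p)" by auto
  then show ?case
    by (auto intro!: derivative_eq_intros c pCons.IH
        simp: partial_x_def partial_y_def map_poly_pCons pderiv_pCons algebra_simps)
qed

text \<open>Division by \<open>y - snd p\<close> leaves a remainder in \<open>x\<close> alone; it
  vanishes at \<open>fst p\<close>, hence is divisible by \<open>x - fst p\<close>. Uniqueness of
  the derivative identifies the values of the cofactors at \<open>p\<close>.\<close>

lemma eval2_vanishing_decomposition:
  assumes "eval2 F p = 0"
  obtains A B where "F = (var_x - const2 (fst p)) * A + (var_y - const2 (snd p)) * B"
    "eval2 A p = eval2 (partial_x F) p" "eval2 B p = eval2 (partial_y F) p"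
proof -
  define c where "c = poly F [:snd p:]"
  have "poly (F - [:c:]) [:snd p:] = 0" by (simp add: c_def)
  then have "[:- [:snd p:], 1:] dvd F - [:c:]" by (rule poly_eq_0_iff_dvd[THEN iffD1])
  then obtain B where B: "F - [:c:] = [:- [:snd p:], 1:] * B" by (elim dvdE)
  have "poly c (fst p) = 0" using assms by (simp add: c_def eval2_def)
  then obtain a where a: "c = [:- fst p, 1:] * a"
    by (metis poly_eq_0_iff_dvd dvdE)
  define A where "A = [:a:]"
  have "[:c:] = (var_x - const2 (fst p)) * A"
    by (simp add: a A_def var_x_def const2_def)
  moreover have "[:- [:snd p:], 1:] = var_y - const2 (snd p)"
    by (simp add: var_y_def const2_def)
  ultimately have F: "F = (var_x - const2 (fst p)) * A + (var_y - const2 (snd p)) * B"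
    using B by (metis add.commute diff_add_cancel)
  have F': "eval2 F = (\<lambda>q. (fst q - fst p) * eval2 A q + (snd q - snd p) * eval2 B q)"
    by (subst F) auto
  have "(eval2 F has_derivative (\<lambda>d. eval2 A p * fst d + eval2 B p * snd d)) (at p)"
    unfolding F' by (auto intro!: derivative_eq_intros has_derivative_eval2 simp: algebra_simps)
  then have eq: "(\<lambda>d. eval2 A p * fst d + eval2 B p * snd d) =
     (\<lambda>d. eval2 (partial_x F) p * fst d + eval2 (partial_y F) p * snd d)"
    using has_derivative_eval2 has_derivative_unique by blast
  show thesis
    using that[OF F] fun_cong[OF eq, of "(1,0)"] fun_cong[OF eq, of "(0,1)"] by simp
qed

lemma continuous_on_eval2 [continuous_intros]:
  "continuous_on S g \<Longrightarrow> continuous_on S (\<lambda>x. eval2 F (g x))"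
  by (rule continuous_on_compose2[of UNIV "eval2 F"])
    (auto intro!: continuous_at_imp_continuous_on has_derivative_continuous[OF has_derivative_eval2])

lemma holomorphic_on_eval2:
  assumes "g holomorphic_on S" "h holomorphic_on S"
  shows "(\<lambda>t. eval2 F (g t, h t)) holomorphic_on S"
proof (induction F)
  case 0 then show ?case by simp
next
  case (pCons c F)
  have "(\<lambda>t. poly c (g t)) holomorphic_on S"
    using assms(1) by (induction c) (auto intro!: holomorphic_intros)
  with pCons assms show ?case by (auto intro!: holomorphic_intros)
qed

section \<open>Local charts of the curve\<close>

text \<open>For \<open>\<Phi> (x, y) = (x, F x y)\<close>, injectivity near the point comes from a
  Lipschitz estimate in \<open>y\<close>, openness of the image from invariance of domain, and
  differentiability of \<open>h\<close> from the inverse function theorem. Curried arguments allow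
  use with the coordinates exchanged.\<close>

lemma analytic_implicit_function:
  fixes F Fx Fy :: "complex \<Rightarrow> complex \<Rightarrow> complex"
  assumes der: "\<And>x y. ((\<lambda>z. F (fst z) (snd z)) has_derivative (\<lambda>d. Fx x y * fst d + Fy x y * snd d)) (at (x, y))"
    and cont: "continuous_on UNIV (\<lambda>z. Fy (fst z) (snd z))"
    and zero: "F x0 y0 = 0" and nz: "Fy x0 y0 \<noteq> 0"
  obtains h r e where "r > 0" "e > 0" "h holomorphic_on ball x0 r"
    "\<And>x y. x \<in> ball x0 r \<Longrightarrow> y \<in> ball y0 e \<Longrightarrow> F x y = 0 \<longleftrightarrow> y = h x"
    "\<And>x. x \<in> ball x0 r \<Longrightarrow> h x \<in> ball y0 e"
    "\<And>x. x \<in> ball x0 r \<Longrightarrow> Fy x (h x) \<noteq> 0"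
proof -
  define C where "C = Fy x0 y0"
  have C: "norm C > 0" using nz by (simp add: C_def)
  have "continuous (at (x0,y0)) (\<lambda>z. Fy (fst z) (snd z))"
    using cont by (simp add: continuous_on_eq_continuous_at)
  then have "\<forall>\<epsilon>>0. \<exists>d>0. \<forall>z. dist z (x0,y0) < d \<longrightarrow> dist (Fy (fst z) (snd z)) C < \<epsilon>"
    by (simp only: continuous_at_eps_delta C_def fst_conv snd_conv)
  then have "\<exists>d>0. \<forall>z. dist z (x0,y0) < d \<longrightarrow> dist (Fy (fst z) (snd z)) C < norm C / 2"
    using half_gt_zero[OF C] by blast
  then obtain d where d: "d > 0" "\<And>z. dist z (x0,y0) < d \<Longrightarrow> dist (Fy (fst z) (snd z)) C < norm C / 2"
    by blast
  \<comment> \<open>Halving makes the product of the two \<open>e\<close>-balls fit into the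
    \<open>d\<close>-ball of the product metric.\<close>
  define e where "e = d / 2"
  have e: "e > 0" using d by (simp add: e_def)
  have near: "norm (Fy x y - C) < norm C / 2" if "x \<in> ball x0 e" "y \<in> ball y0 e" for x y
  proof -
    have "dist (x, y) (x0, y0) \<le> dist x x0 + dist y y0"
      unfolding dist_Pair_Pair by (rule sqrt_sum_squares_le_sum) auto
    also have "\<dots> < d" using that by (auto simp: e_def dist_commute)
    finally show ?thesis using d(2)[of "(x, y)"] by (simp add: dist_norm)
  qed
  define S where "S = ball x0 e \<times> ball y0 e"
  have S: "open S" "(x0, y0) \<in> S" using e by (auto simp: S_def open_Times)
  have dery: "(F x has_field_derivative Fy x y) (at y within T)" for x y T
  proof -
    have "((\<lambda>y. (x, y)) has_derivative (\<lambda>d. (0, d))) (at y)"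
      by (auto intro!: derivative_eq_intros)
    from has_derivative_compose[OF this der[of x y]] have "(F x has_field_derivative Fy x y) (at y)"
      by (simp add: has_field_derivative_def mult_commute_abs)
    then show ?thesis by (rule has_field_derivative_at_within)
  qed
  define \<Phi> where "\<Phi> = (\<lambda>z. (fst z, F (fst z) (snd z)))"
  have der\<Phi>: "(\<Phi> has_derivative (\<lambda>d. (fst d, Fx x y * fst d + Fy x y * snd d))) (at (x, y))" for x y
    unfolding \<Phi>_def by (auto intro!: derivative_eq_intros der)
  have cont\<Phi>: "continuous_on T \<Phi>" for T
  proof (rule continuous_at_imp_continuous_on, rule ballI)
    show "isCont \<Phi> z" for z
      using has_derivative_continuous[OF der\<Phi>[of "fst z" "snd z"]] by (simp only: prod.collapse)
  qed
  have inj: "inj_on \<Phi> S"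
  proof (rule inj_onI)
    fix z w assume zw: "z \<in> S" "w \<in> S" "\<Phi> z = \<Phi> w"
    define x y y' where "x = fst z" and "y = snd z" and "y' = snd w"
    have z: "z = (x, y)" "w = (x, y')" "F x y = F x y'"
      using zw(3) by (auto simp: \<Phi>_def x_def y_def y'_def prod_eq_iff)
    \<comment> \<open>Without its linear part \<open>C * y\<close>, the function has Lipschitz
      constant \<open>norm C / 2\<close> in \<open>y\<close>. Equal values of \<open>F\<close> turn
      the left side into \<open>norm C * norm (y - y')\<close>, which forces
      \<open>y = y'\<close>.\<close>
    have "norm ((F x y - C * y) - (F x y' - C * y')) \<le> norm C / 2 * norm (y - y')"
    proof (rule field_differentiable_bound[where S = "ball y0 e" and f' = "\<lambda>y. Fy x y - C"])
      show "((\<lambda>y. F x y - C * y) has_field_derivative Fy x v - C) (at v within ball y0 e)" for v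
        by (auto intro!: derivative_eq_intros dery)
      show "norm (Fy x v - C) \<le> norm C / 2" if "v \<in> ball y0 e" for v
        using near[of x v] zw(1) z that by (auto simp: S_def intro: less_imp_le)
    qed (use zw z in \<open>auto simp: S_def\<close>)
    also have "(F x y - C * y) - (F x y' - C * y') = - (C * (y - y'))"
      using z(3) by (simp add: algebra_simps)
    finally have "norm C * norm (y - y') \<le> norm C * (norm (y - y') / 2)"
      by (simp add: norm_mult)
    then have "norm (y - y') \<le> norm (y - y') / 2" using C by (simp only: mult_le_cancel_left_pos)
    then show "z = w" using z by simp
  qed
  have op: "open (\<Phi> ` S)" using invariance_of_domain[OF cont\<Phi> S(1) inj] .
  have "open ((\<lambda>x. (x, 0)) -` (\<Phi> ` S))"
    by (intro open_vimage op continuous_intros)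
  moreover have "(x0, 0) \<in> \<Phi> ` S"
    using S(2) zero by (force simp: \<Phi>_def intro!: image_eqI[of _ _ "(x0, y0)"])
  ultimately obtain r where r: "r > 0" "ball x0 r \<subseteq> (\<lambda>x. (x, 0)) -` (\<Phi> ` S)"
    by (metis open_contains_ball vimageI)
  define g where "g = inv_into S \<Phi>"
  have g: "g (\<Phi> z) = z" if "z \<in> S" for z using that inj by (simp add: g_def)
  define h where "h = (\<lambda>x. snd (g (x, 0)))"
  have h: "(x, h x) \<in> S \<and> F x (h x) = 0" if "x \<in> ball x0 r" for x
  proof -
    have "(x, 0) \<in> \<Phi> ` S" using r(2) that by blast
    then obtain z where z: "z \<in> S" "\<Phi> z = (x, 0)" by (metis imageE)
    then have "h x = snd z" using g[of z] by (simp add: h_def)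
    moreover have "fst z = x" "F x (snd z) = 0" using z(2) by (auto simp: \<Phi>_def)
    ultimately show ?thesis using z(1) by (metis prod.collapse)
  qed
  have nz: "Fy x y \<noteq> 0" if "(x, y) \<in> S" for x y
    using near[of x y] that C by (auto simp: S_def)
  show thesis
  proof (rule that[of r e h])
    show "r > 0" "e > 0" by fact+
    show "h x \<in> ball y0 e" "Fy x (h x) \<noteq> 0" if "x \<in> ball x0 r" for x
      using h[OF that] nz by (auto simp: S_def)
    show "F x y = 0 \<longleftrightarrow> y = h x" if "x \<in> ball x0 r" "y \<in> ball y0 e" for x y
    proof
      assume "F x y = 0"
      with h[OF that(1)] have "\<Phi> (x, y) = \<Phi> (x, h x)" by (simp add: \<Phi>_def)
      moreover have "(x, y) \<in> S" using h[OF that(1)] that(2) by (auto simp: S_def)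
      ultimately show "y = h x" using inj_onD[OF inj] h[OF that(1)] by blast
    qed (use h[OF that(1)] in simp)
    show "h holomorphic_on ball x0 r"
    proof (rule holomorphic_onI)
      fix x assume x: "x \<in> ball x0 r"
      let ?Fx = "Fx x (h x)" and ?Fy = "Fy x (h x)"
      \<comment> \<open>The differential of \<open>\<Phi>\<close> is triangular, so its inverse is
        explicit. On vectors \<open>(d, 0)\<close> its second component is complex linear, which
        makes \<open>h\<close> complex differentiable.\<close>
      have "(g has_derivative (\<lambda>d. (fst d, (snd d - ?Fx * fst d) / ?Fy))) (at (\<Phi> (x, h x)))"
        using h[OF x] nz[of x "h x"]
        by (intro has_derivative_inverse_strong[OF S(1) _ cont\<Phi> g der\<Phi>]) (auto simp: fun_eq_iff)
      then have "(g has_derivative (\<lambda>d. (fst d, (snd d - ?Fx * fst d) / ?Fy))) (at (x, 0))"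
        using h[OF x] by (simp add: \<Phi>_def)
      moreover have "((\<lambda>x. (x, 0)) has_derivative (\<lambda>d. (d, 0))) (at x)"
        by (auto intro!: derivative_eq_intros)
      ultimately have "((\<lambda>x. g (x, 0)) has_derivative (\<lambda>d. (d, - (?Fx * d) / ?Fy))) (at x)"
        using has_derivative_compose by fastforce
      then have "(h has_derivative (\<lambda>d. - (?Fx * d) / ?Fy)) (at x)"
        unfolding h_def using has_derivative_snd by fastforce
      moreover have "(\<lambda>d. - (?Fx * d) / ?Fy) = (*) (- ?Fx / ?Fy)" by auto
      ultimately have "(h has_field_derivative - ?Fx / ?Fy) (at x)"
        by (simp only: has_field_derivative_def)
      then show "h field_differentiable at x within ball x0 r"
        by (meson has_field_derivative_at_within field_differentiable_def)
    qed
  qed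
qed

text \<open>The parameter is the coordinate \<open>coord\<close>, shifted to be 0 at
  \<open>p\<close>; the two choices of \<open>coord\<close> cover both ways of writing the curve as
  a graph. The equality in \<open>image\<close> says that no further branch of the curve meets
  \<open>U\<close>.\<close>

locale curve_chart =
  fixes f :: "complex poly poly" and p :: "complex \<times> complex"
    and \<gamma> :: "complex \<Rightarrow> complex \<times> complex" and r :: real
    and U :: "(complex \<times> complex) set" and coord :: "complex \<times> complex \<Rightarrow> complex"
  assumes coord: "coord = fst \<or> coord = snd"
    and r: "r > 0"
    and U: "open U"
    and holX: "(\<lambda>t. fst (\<gamma> t)) holomorphic_on ball 0 r"
    and holY: "(\<lambda>t. snd (\<gamma> t)) holomorphic_on ball 0 r"
    and image: "\<gamma> ` ball 0 r = curve f \<inter> U"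
    and coord_chart: "t \<in> ball 0 r \<Longrightarrow> coord (\<gamma> t) = coord p + t"
    and chart_0: "\<gamma> 0 = p"
    and regular: "\<gamma> ` ball 0 r \<subseteq> curve_reg f"
begin

lemma inj_chart: "inj_on \<gamma> (ball 0 r)"
  by (rule inj_onI) (metis add_left_cancel coord_chart)

lemma has_derivX: "t \<in> ball 0 r \<Longrightarrow> ((\<lambda>t. fst (\<gamma> t)) has_field_derivative deriv (\<lambda>t. fst (\<gamma> t)) t) (at t)"
  using holX holomorphic_derivI open_ball by blast

lemma has_derivY: "t \<in> ball 0 r \<Longrightarrow> ((\<lambda>t. snd (\<gamma> t)) has_field_derivative deriv (\<lambda>t. snd (\<gamma> t)) t) (at t)"
  using holY holomorphic_derivI open_ball by blast

lemma immersion: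
  assumes "t \<in> ball 0 r"
  shows "deriv (\<lambda>t. fst (\<gamma> t)) t \<noteq> 0 \<or> deriv (\<lambda>t. snd (\<gamma> t)) t \<noteq> 0"
proof -
  have "\<forall>\<^sub>F s in nhds t. coord (\<gamma> s) = coord p + s"
    using assms coord_chart
    by (intro eventually_nhds_in_open[of "ball 0 r", THEN eventually_mono]) auto
  then have "deriv (\<lambda>s. coord (\<gamma> s)) t = deriv (\<lambda>s. coord p + s) t"
    by (rule deriv_cong_ev) simp
  also have "\<dots> = 1" by (auto intro!: DERIV_imp_deriv derivative_eq_intros)
  finally show ?thesis using coord by auto
qed

lemma holomorphic_on_eval2_chart: "(\<lambda>t. eval2 F (\<gamma> t)) holomorphic_on ball 0 r"
  using holomorphic_on_eval2[OF holX holY] by simp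

lemma holomorphic_on_sq_dist_chart: "(\<lambda>t. sq_dist u (\<gamma> t)) holomorphic_on ball 0 r"
  unfolding sq_dist_def by (intro holomorphic_intros holX holY)

lemma continuous_on_chart: "continuous_on (ball 0 r) \<gamma>"
  using continuous_on_Pair[OF holomorphic_on_imp_continuous_on[OF holX]
      holomorphic_on_imp_continuous_on[OF holY]] by simp

text \<open>Near 0 the germ \<open>\<delta>\<close> stays in \<open>U\<close> by continuity, hence
  in the image of the chart, and \<open>\<phi>\<close> is read off from the coordinate. As
  \<open>\<delta>' = \<gamma>' \<phi>'\<close> componentwise, an immersion forces
  \<open>\<phi>' \<noteq> 0\<close>.\<close>

lemma local_param_factors:
  assumes "local_param f (\<gamma> t) \<delta>" "t \<in> ball 0 r"
  obtains \<phi> \<rho> where "\<rho> > 0" "\<phi> holomorphic_on ball 0 \<rho>" "\<phi> 0 = t" "\<phi> ` ball 0 \<rho> \<subseteq> ball 0 r"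
    "\<And>s. s \<in> ball 0 \<rho> \<Longrightarrow> \<delta> s = \<gamma> (\<phi> s)" "deriv \<phi> 0 \<noteq> 0"
proof -
  from assms(1) obtain \<rho>0 where \<delta>: "\<rho>0 > 0" "(\<lambda>t. fst (\<delta> t)) holomorphic_on ball 0 \<rho>0"
      "(\<lambda>t. snd (\<delta> t)) holomorphic_on ball 0 \<rho>0" "\<delta> ` ball 0 \<rho>0 \<subseteq> curve f" "\<delta> 0 = \<gamma> t"
      "deriv (\<lambda>t. fst (\<delta> t)) 0 \<noteq> 0 \<or> deriv (\<lambda>t. snd (\<delta> t)) 0 \<noteq> 0"
    by (auto simp: local_param_def)
  have "continuous_on (ball 0 \<rho>0) \<delta>"
    using continuous_on_Pair[OF holomorphic_on_imp_continuous_on[OF \<delta>(2)]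
        holomorphic_on_imp_continuous_on[OF \<delta>(3)]] by simp
  then have "open (ball 0 \<rho>0 \<inter> \<delta> -` U)"
    using U by (simp add: continuous_on_open_vimage Int_commute)
  moreover have "0 \<in> ball 0 \<rho>0 \<inter> \<delta> -` U"
    using \<delta>(1,5) assms(2) image by auto
  ultimately obtain \<rho> where \<rho>: "\<rho> > 0" "ball 0 \<rho> \<subseteq> ball 0 \<rho>0 \<inter> \<delta> -` U"
    by (meson open_contains_ball)
  define \<phi> where "\<phi> s = coord (\<delta> s) - coord p" for s
  have fac: "\<phi> s \<in> ball 0 r \<and> \<delta> s = \<gamma> (\<phi> s)" if "s \<in> ball 0 \<rho>" for s
  proof -
    have "\<delta> s \<in> \<gamma> ` ball 0 r" unfolding image using \<rho>(2) \<delta>(4) that by blast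
    then obtain s' where s': "s' \<in> ball 0 r" "\<delta> s = \<gamma> s'" by blast
    then have "\<phi> s = s'" using coord_chart by (simp add: \<phi>_def)
    then show ?thesis using s' by simp
  qed
  have "(\<lambda>s. coord (\<delta> s)) holomorphic_on ball 0 \<rho>0" using coord \<delta>(2,3) by auto
  then have hol: "\<phi> holomorphic_on ball 0 \<rho>"
    unfolding \<phi>_def using \<rho>(2) by (intro holomorphic_intros) (blast intro: holomorphic_on_subset)
  have \<phi>0: "\<phi> 0 = t" using \<delta>(5) coord_chart[OF assms(2)] by (simp add: \<phi>_def)
  have d\<phi>: "(\<phi> has_field_derivative deriv \<phi> 0) (at 0)"
    using hol \<rho>(1) by (intro holomorphic_derivI[of _ "ball 0 \<rho>"]) auto
  have ev: "\<forall>\<^sub>F s in nhds 0. \<delta> s = \<gamma> (\<phi> s)"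
    using fac \<rho>(1) by (intro eventually_nhds_in_open[of "ball 0 \<rho>", THEN eventually_mono]) auto
  have "deriv (\<lambda>s. fst (\<delta> s)) 0 = deriv (\<lambda>t. fst (\<gamma> t)) t * deriv \<phi> 0"
  proof -
    have "deriv (\<lambda>s. fst (\<delta> s)) 0 = deriv (\<lambda>s. fst (\<gamma> (\<phi> s))) 0"
      by (rule deriv_cong_ev) (use ev in \<open>auto elim: eventually_mono\<close>)
    also have "\<dots> = deriv (\<lambda>t. fst (\<gamma> t)) t * deriv \<phi> 0"
      by (rule DERIV_imp_deriv, rule DERIV_chain2[OF _ d\<phi>]) (use has_derivX assms(2) \<phi>0 in simp)
    finally show ?thesis .
  qed
  moreover have "deriv (\<lambda>s. snd (\<delta> s)) 0 = deriv (\<lambda>t. snd (\<gamma> t)) t * deriv \<phi> 0"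
  proof -
    have "deriv (\<lambda>s. snd (\<delta> s)) 0 = deriv (\<lambda>s. snd (\<gamma> (\<phi> s))) 0"
      by (rule deriv_cong_ev) (use ev in \<open>auto elim: eventually_mono\<close>)
    also have "\<dots> = deriv (\<lambda>t. snd (\<gamma> t)) t * deriv \<phi> 0"
      by (rule DERIV_imp_deriv, rule DERIV_chain2[OF _ d\<phi>]) (use has_derivY assms(2) \<phi>0 in simp)
    finally show ?thesis .
  qed
  ultimately have "deriv \<phi> 0 \<noteq> 0" using \<delta>(6) by auto
  then show thesis using that[OF \<rho>(1) hol \<phi>0] fac by blast
qed

lemma local_param_chart:
  assumes "t \<in> ball 0 r"
  shows "local_param f (\<gamma> t) (\<lambda>s. \<gamma> (t + s))"
proof -
  define \<rho> where "\<rho> = r - norm t"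
  have \<rho>: "\<rho> > 0" using assms by (simp add: \<rho>_def)
  have sub: "(+) t ` ball 0 \<rho> \<subseteq> ball 0 r"
  proof (rule image_subsetI)
    fix s :: complex assume "s \<in> ball 0 \<rho>"
    then show "t + s \<in> ball 0 r" using norm_triangle_ineq[of t s] by (simp add: \<rho>_def)
  qed
  have "(\<lambda>s. g (t + s)) holomorphic_on ball 0 \<rho>" if "g holomorphic_on ball 0 r" for g
    using holomorphic_on_compose_gen[OF _ that sub] by (simp add: o_def holomorphic_intros)
  from this[OF holX] this[OF holY] have "(\<lambda>s. fst (\<gamma> (t + s))) holomorphic_on ball 0 \<rho>"
      "(\<lambda>s. snd (\<gamma> (t + s))) holomorphic_on ball 0 \<rho>" by auto
  moreover have "(\<lambda>s. \<gamma> (t + s)) ` ball 0 \<rho> \<subseteq> curve f"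
    using sub image by blast
  moreover have "deriv (\<lambda>s. fst (\<gamma> (t + s))) 0 = deriv (\<lambda>s. fst (\<gamma> s)) t"
      "deriv (\<lambda>s. snd (\<gamma> (t + s))) 0 = deriv (\<lambda>s. snd (\<gamma> s)) t"
    by (simp_all add: deriv_shift_0[of _ t] o_def)
  ultimately show ?thesis
    using \<rho> immersion[OF assms] by (auto simp: local_param_def)
qed

text \<open>The chain rule for \<open>E\<close> composed with \<open>\<phi>\<close>, where
  \<open>c\<close> and \<open>d\<close> are the first and second derivatives of
  \<open>\<phi>\<close> at 0. Criticality and nondegeneracy are thus independent of the
  parametrization, so the existential definitions can be tested on the chart.\<close>

lemma deriv_along_local_param:
  fixes u :: "complex \<times> complex"
  assumes "local_param f (\<gamma> t) \<delta>" "t \<in> ball 0 r"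
  defines "E \<equiv> \<lambda>t. sq_dist u (\<gamma> t)"
  obtains c d where "c \<noteq> 0" "deriv (\<lambda>s. sq_dist u (\<delta> s)) 0 = c * deriv E t"
    "(deriv ^^ 2) (\<lambda>s. sq_dist u (\<delta> s)) 0 = c\<^sup>2 * (deriv ^^ 2) E t + d * deriv E t"
proof -
  obtain \<phi> \<rho> where \<phi>: "\<rho> > 0" "\<phi> holomorphic_on ball 0 \<rho>" "\<phi> 0 = t" "\<phi> ` ball 0 \<rho> \<subseteq> ball 0 r"
    "\<And>s. s \<in> ball 0 \<rho> \<Longrightarrow> \<delta> s = \<gamma> (\<phi> s)" "deriv \<phi> 0 \<noteq> 0"
    using local_param_factors[OF assms(1,2)] by blast
  have hE: "E holomorphic_on ball 0 r" unfolding E_def by (rule holomorphic_on_sq_dist_chart)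
  have d1: "((\<lambda>s. sq_dist u (\<delta> s)) has_field_derivative deriv E (\<phi> s) * deriv \<phi> s) (at s)"
    if s: "s \<in> ball 0 \<rho>" for s
  proof -
    have "((\<lambda>s. E (\<phi> s)) has_field_derivative deriv E (\<phi> s) * deriv \<phi> s) (at s)"
      using s \<phi>(2,4) hE by (intro DERIV_chain2[of E] holomorphic_derivI) (auto simp: image_subset_iff)
    moreover have "\<forall>\<^sub>F x in nhds s. sq_dist u (\<delta> x) = E (\<phi> x)"
      using \<phi>(5) s unfolding E_def
      by (intro eventually_nhds_in_open[of "ball 0 \<rho>", THEN eventually_mono]) auto
    ultimately show ?thesis by (subst DERIV_cong_ev[OF refl _ refl])
  qed
  have "\<forall>\<^sub>F s in nhds 0. deriv (\<lambda>s. sq_dist u (\<delta> s)) s = deriv E (\<phi> s) * deriv \<phi> s"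
    using d1 \<phi>(1) by (intro eventually_nhds_in_open[of "ball 0 \<rho>", THEN eventually_mono])
      (auto intro: DERIV_imp_deriv)
  then have "deriv (deriv (\<lambda>s. sq_dist u (\<delta> s))) 0 = deriv (\<lambda>s. deriv E (\<phi> s) * deriv \<phi> s) 0"
    by (rule deriv_cong_ev) simp
  also have "\<dots> = deriv (deriv E) t * deriv \<phi> 0 * deriv \<phi> 0 + deriv E t * deriv (deriv \<phi>) 0"
  proof (rule DERIV_imp_deriv)
    have "((\<lambda>s. deriv E (\<phi> s)) has_field_derivative deriv (deriv E) (\<phi> 0) * deriv \<phi> 0) (at 0)"
      using \<phi> hE assms(2)
      by (intro DERIV_chain2[of "deriv E"] holomorphic_derivI[of _ "ball 0 r"]
          holomorphic_derivI[of _ "ball 0 \<rho>"] holomorphic_deriv) auto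
    moreover have "(deriv \<phi> has_field_derivative deriv (deriv \<phi>) 0) (at 0)"
      using \<phi> by (intro holomorphic_derivI[of _ "ball 0 \<rho>"] holomorphic_deriv) auto
    ultimately show "((\<lambda>s. deriv E (\<phi> s) * deriv \<phi> s) has_field_derivative
        deriv (deriv E) t * deriv \<phi> 0 * deriv \<phi> 0 + deriv E t * deriv (deriv \<phi>) 0) (at 0)"
      using \<phi>(3) by (auto intro!: derivative_eq_intros)
  qed
  finally show thesis
    using \<phi>(1,3,6) DERIV_imp_deriv[OF d1[of 0]]
    by (intro that[of "deriv \<phi> 0" "deriv (deriv \<phi>) 0"])
       (auto simp: numeral_2_eq_2 algebra_simps)
qed

section \<open>Critical and Morse points in terms of the chart\<close>

lemma critical_point_chart_iff:
  assumes "t \<in> ball 0 r"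
  shows "critical_point f u (\<gamma> t) \<longleftrightarrow> deriv (\<lambda>t. sq_dist u (\<gamma> t)) t = 0"
proof
  assume "critical_point f u (\<gamma> t)"
  then obtain \<delta> where "local_param f (\<gamma> t) \<delta>" "deriv (\<lambda>s. sq_dist u (\<delta> s)) 0 = 0"
    by (auto simp: critical_point_def)
  then show "deriv (\<lambda>t. sq_dist u (\<gamma> t)) t = 0"
    using deriv_along_local_param[OF _ assms, of \<delta> u] by (metis mult_eq_0_iff)
next
  assume "deriv (\<lambda>t. sq_dist u (\<gamma> t)) t = 0"
  then have "deriv (\<lambda>s. sq_dist u (\<gamma> (t + s))) 0 = 0"
    by (simp add: deriv_shift_0[of _ t] o_def)
  then show "critical_point f u (\<gamma> t)"
    unfolding critical_point_def using local_param_chart[OF assms] regular assms by blast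
qed

lemma morse_point_chart_iff:
  assumes "t \<in> ball 0 r"
  shows "morse_point f u (\<gamma> t) \<longleftrightarrow>
    deriv (\<lambda>t. sq_dist u (\<gamma> t)) t = 0 \<and> (deriv ^^ 2) (\<lambda>t. sq_dist u (\<gamma> t)) t \<noteq> 0"
proof
  assume "morse_point f u (\<gamma> t)"
  then obtain \<delta> where \<delta>: "local_param f (\<gamma> t) \<delta>" "deriv (\<lambda>s. sq_dist u (\<delta> s)) 0 = 0"
    "(deriv ^^ 2) (\<lambda>s. sq_dist u (\<delta> s)) 0 \<noteq> 0"
    by (auto simp: morse_point_def)
  obtain c d where "c \<noteq> 0" "deriv (\<lambda>s. sq_dist u (\<delta> s)) 0 = c * deriv (\<lambda>t. sq_dist u (\<gamma> t)) t"
    "(deriv ^^ 2) (\<lambda>s. sq_dist u (\<delta> s)) 0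
      = c\<^sup>2 * (deriv ^^ 2) (\<lambda>t. sq_dist u (\<gamma> t)) t + d * deriv (\<lambda>t. sq_dist u (\<gamma> t)) t"
    using deriv_along_local_param[OF \<delta>(1) assms, of u] by blast
  with \<delta> show "deriv (\<lambda>t. sq_dist u (\<gamma> t)) t = 0 \<and> (deriv ^^ 2) (\<lambda>t. sq_dist u (\<gamma> t)) t \<noteq> 0"
    by auto
next
  assume "deriv (\<lambda>t. sq_dist u (\<gamma> t)) t = 0 \<and> (deriv ^^ 2) (\<lambda>t. sq_dist u (\<gamma> t)) t \<noteq> 0"
  then have "deriv (\<lambda>s. sq_dist u (\<gamma> (t + s))) 0 = 0" "(deriv ^^ 2) (\<lambda>s. sq_dist u (\<gamma> (t + s))) 0 \<noteq> 0"
    using deriv_shift_0[of _ t] higher_deriv_shift_0[of 2 _ t] by (simp_all add: o_def)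
  then show "morse_point f u (\<gamma> t)"
    unfolding morse_point_def using local_param_chart[OF assms] regular assms by blast
qed

lemma deriv_sq_dist_chart:
  assumes "t \<in> ball 0 r"
  shows "deriv (\<lambda>t. sq_dist u (\<gamma> t)) t =
    2 * ((fst (\<gamma> t) - fst u) * deriv (\<lambda>t. fst (\<gamma> t)) t + (snd (\<gamma> t) - snd u) * deriv (\<lambda>t. snd (\<gamma> t)) t)"
  unfolding sq_dist_def
  by (rule DERIV_imp_deriv)
    (auto intro!: derivative_eq_intros has_derivX[OF assms] has_derivY[OF assms] simp: algebra_simps)

end

text \<open>The implicit function theorem solves for \<open>y\<close> if \<open>partial_y f\<close>
  is nonzero at \<open>p\<close>, and for \<open>x\<close> otherwise. Since that partial derivative
  stays nonzero on the graph, every chart point is regular.\<close>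

lemma curve_chart_exists:
  assumes "p \<in> curve_reg f"
  obtains \<gamma> r U coord where "curve_chart f p \<gamma> r U coord" "p \<in> U"
proof (cases "eval2 (partial_y f) p = 0")
  case False
  obtain h r e where h: "r > 0" "e > 0" "h holomorphic_on ball (fst p) r"
    "\<And>x y. x \<in> ball (fst p) r \<Longrightarrow> y \<in> ball (snd p) e \<Longrightarrow> eval2 f (x, y) = 0 \<longleftrightarrow> y = h x"
    "\<And>x. x \<in> ball (fst p) r \<Longrightarrow> h x \<in> ball (snd p) e"
    "\<And>x. x \<in> ball (fst p) r \<Longrightarrow> eval2 (partial_y f) (x, h x) \<noteq> 0"
  proof (rule analytic_implicit_function[of "\<lambda>x y. eval2 f (x, y)" "\<lambda>x y. eval2 (partial_x f) (x, y)"
        "\<lambda>x y. eval2 (partial_y f) (x, y)" "fst p" "snd p"])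
    show "eval2 f (fst p, snd p) = 0" "eval2 (partial_y f) (fst p, snd p) \<noteq> 0"
      using assms False by (auto simp: curve_reg_def curve_def)
  qed (use has_derivative_eval2 in \<open>auto intro!: continuous_intros\<close>)
  define \<gamma> where "\<gamma> t = (fst p + t, h (fst p + t))" for t
  have shift: "fst p + t \<in> ball (fst p) r \<longleftrightarrow> t \<in> ball 0 r" for t by (simp add: dist_norm)
  have "curve_chart f p \<gamma> r (ball (fst p) r \<times> ball (snd p) e) fst"
  proof
    show "(\<lambda>t. snd (\<gamma> t)) holomorphic_on ball 0 r"
      unfolding \<gamma>_def snd_conv using shift
      by (intro holomorphic_on_compose_gen[OF _ h(3), of "\<lambda>t. fst p + t", unfolded o_def]
          holomorphic_intros) auto
    show "\<gamma> ` ball 0 r = curve f \<inter> ball (fst p) r \<times> ball (snd p) e"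
    proof (intro equalityI subsetI)
      fix q assume "q \<in> \<gamma> ` ball 0 r"
      then show "q \<in> curve f \<inter> ball (fst p) r \<times> ball (snd p) e"
        using h(4,5) shift by (auto simp: \<gamma>_def curve_def simp del: mem_ball)
    next
      fix q assume q: "q \<in> curve f \<inter> ball (fst p) r \<times> ball (snd p) e"
      then have "snd q = h (fst q)" using h(4)[of "fst q" "snd q"] by (auto simp: curve_def)
      then have "q = \<gamma> (fst q - fst p)" by (simp add: \<gamma>_def prod_eq_iff)
      moreover have "fst q - fst p \<in> ball 0 r" using q shift[of "fst q - fst p"] by auto
      ultimately show "q \<in> \<gamma> ` ball 0 r" by blast
    qed
    show "\<gamma> ` ball 0 r \<subseteq> curve_reg f"
      using h(4,5,6) shift by (auto simp: \<gamma>_def curve_def curve_reg_def simp del: mem_ball)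
    show "\<gamma> 0 = p"
      using h(1,2) h(4)[of "fst p" "snd p"] assms by (auto simp: \<gamma>_def curve_reg_def curve_def prod_eq_iff)
  qed (use h(1) in \<open>auto simp: \<gamma>_def open_Times intro!: holomorphic_intros\<close>)
  then show thesis using that h(1,2) by (simp add: mem_Times_iff)
next
  case True
  obtain h r e where h: "r > 0" "e > 0" "h holomorphic_on ball (snd p) r"
    "\<And>y x. y \<in> ball (snd p) r \<Longrightarrow> x \<in> ball (fst p) e \<Longrightarrow> eval2 f (x, y) = 0 \<longleftrightarrow> x = h y"
    "\<And>y. y \<in> ball (snd p) r \<Longrightarrow> h y \<in> ball (fst p) e"
    "\<And>y. y \<in> ball (snd p) r \<Longrightarrow> eval2 (partial_x f) (h y, y) \<noteq> 0"
  proof (rule analytic_implicit_function[of "\<lambda>y x. eval2 f (x, y)" "\<lambda>y x. eval2 (partial_y f) (x, y)"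
        "\<lambda>y x. eval2 (partial_x f) (x, y)" "snd p" "fst p"])
    fix y x :: complex
    have "((\<lambda>z. (snd z, fst z)) has_derivative (\<lambda>d. (snd d, fst d))) (at (y, x))"
      by (auto intro!: derivative_eq_intros)
    moreover have "(eval2 f has_derivative
        (\<lambda>d. eval2 (partial_x f) (x, y) * fst d + eval2 (partial_y f) (x, y) * snd d))
        (at ((\<lambda>z. (snd z, fst z)) (y, x)))"
      using has_derivative_eval2[of f "(x, y)"] by simp
    ultimately have "((\<lambda>z. eval2 f (snd z, fst z)) has_derivative
        (\<lambda>d. eval2 (partial_x f) (x, y) * fst (snd d, fst d)
            + eval2 (partial_y f) (x, y) * snd (snd d, fst d))) (at (y, x))"
      by (rule has_derivative_compose)
    then
    show "((\<lambda>z. eval2 f (snd z, fst z)) has_derivative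
       (\<lambda>d. eval2 (partial_y f) (x, y) * fst d + eval2 (partial_x f) (x, y) * snd d)) (at (y, x))"
      by (simp add: add.commute)
    show "eval2 f (fst p, snd p) = 0" "eval2 (partial_x f) (fst p, snd p) \<noteq> 0"
      using assms True by (auto simp: curve_reg_def curve_def)
  qed (auto intro!: continuous_intros)
  define \<gamma> where "\<gamma> t = (h (snd p + t), snd p + t)" for t
  have shift: "snd p + t \<in> ball (snd p) r \<longleftrightarrow> t \<in> ball 0 r" for t by (simp add: dist_norm)
  have "curve_chart f p \<gamma> r (ball (fst p) e \<times> ball (snd p) r) snd"
  proof
    show "(\<lambda>t. fst (\<gamma> t)) holomorphic_on ball 0 r"
      unfolding \<gamma>_def fst_conv using shift
      by (intro holomorphic_on_compose_gen[OF _ h(3), of "\<lambda>t. snd p + t", unfolded o_def]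
          holomorphic_intros) auto
    show "\<gamma> ` ball 0 r = curve f \<inter> ball (fst p) e \<times> ball (snd p) r"
    proof (intro equalityI subsetI)
      fix q assume "q \<in> \<gamma> ` ball 0 r"
      then show "q \<in> curve f \<inter> ball (fst p) e \<times> ball (snd p) r"
        using h(4,5) shift by (auto simp: \<gamma>_def curve_def simp del: mem_ball)
    next
      fix q assume q: "q \<in> curve f \<inter> ball (fst p) e \<times> ball (snd p) r"
      then have "fst q = h (snd q)" using h(4)[of "snd q" "fst q"] by (auto simp: curve_def)
      then have "q = \<gamma> (snd q - snd p)" by (simp add: \<gamma>_def prod_eq_iff)
      moreover have "snd q - snd p \<in> ball 0 r" using q shift[of "snd q - snd p"] by auto
      ultimately show "q \<in> \<gamma> ` ball 0 r" by blast
    qed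
    show "\<gamma> ` ball 0 r \<subseteq> curve_reg f"
      using h(4,5,6) shift by (auto simp: \<gamma>_def curve_def curve_reg_def simp del: mem_ball)
    show "\<gamma> 0 = p"
      using h(1,2) h(4)[of "snd p" "fst p"] assms by (auto simp: \<gamma>_def curve_reg_def curve_def prod_eq_iff)
  qed (use h(1) in \<open>auto simp: \<gamma>_def open_Times intro!: holomorphic_intros\<close>)
  then show thesis using that h(1,2) by (simp add: mem_Times_iff)
qed

section \<open>Existence of Morse deformations\<close>

text \<open>A nonconstant holomorphic function has isolated zeros and \<open>S\<close> is a
  countable union of compact sets; a constant one has no zeros because it is nonzero at
  \<open>t\<close>.\<close>

lemma countable_holomorphic_zeros:
  assumes "g holomorphic_on S" "open S" "connected S" "t \<in> S" "g t \<noteq> 0"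
  shows "countable {t \<in> S. g t = 0}"
proof (cases "g constant_on S")
  case True
  then have "{t \<in> S. g t = 0} = {}" using assms(4,5) by (auto simp: constant_on_def)
  then show ?thesis by (simp only: countable_empty)
next
  case False
  moreover have "fsigma S"
  proof -
    obtain C :: "nat \<Rightarrow> complex set" where "\<And>n. compact (C n)" "\<Union> (range C) = S"
      using open_Union_compact_subsets[OF assms(2)] by metis
    then show ?thesis unfolding fsigma_Union_compact by (intro exI[of _ C]) auto
  qed
  ultimately show ?thesis using holomorphic_countable_zeros[OF assms(1-3)] by blast
qed

text \<open>
  The Wronskian of \<open>a\<close> and \<open>b\<close> vanishes at every such \<open>t\<close>; if it vanishes identically, \<open>a\<close> is a
  constant multiple of \<open>b\<close>.
\<close>

lemma countable_common_multipliers: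
  fixes a b :: "complex \<Rightarrow> complex"
  assumes hol: "a holomorphic_on S" "b holomorphic_on S" and S: "open S" "connected S"
    and no_common_zero: "\<And>t. t \<in> S \<Longrightarrow> b t = 0 \<Longrightarrow> deriv b t = 0 \<Longrightarrow> a t = 0 \<Longrightarrow> deriv a t \<noteq> 0"
  shows "countable {s. \<exists>t\<in>S. a t = s * b t \<and> deriv a t = s * deriv b t}"
proof -
  define M where "M t = {s. a t = s * b t \<and> deriv a t = s * deriv b t}" for t
  have M: "countable (M t)" if t: "t \<in> S" for t
  proof -
    \<comment> \<open>Each \<open>t\<close> admits at most one \<open>s\<close>: a nonzero
      coefficient determines it, and if both coefficients vanish there is no solution.\<close>
    consider "b t \<noteq> 0" | "deriv b t \<noteq> 0" | "b t = 0" "deriv b t = 0"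
      by blast
    then have "\<exists>s. M t \<subseteq> {s}"
    proof cases
      case 1 then show ?thesis by (intro exI[of _ "a t / b t"]) (auto simp: M_def)
    next
      case 2 then show ?thesis by (intro exI[of _ "deriv a t / deriv b t"]) (auto simp: M_def)
    next
      case 3 then show ?thesis using no_common_zero[OF t 3] by (auto simp: M_def)
    qed
    then show ?thesis using countable_subset by blast
  qed
  define W where "W t = a t * deriv b t - deriv a t * b t" for t
  have "W holomorphic_on S" unfolding W_def by (intro holomorphic_intros hol holomorphic_deriv S)
  show ?thesis
  proof (cases "\<exists>t\<in>S. W t \<noteq> 0")
    case True
    then have "countable {t \<in> S. W t = 0}"
      using countable_holomorphic_zeros[OF \<open>W holomorphic_on S\<close> S] by blast
    then have "countable (\<Union>t\<in>{t \<in> S. W t = 0}. M t)" using M by auto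
    then show ?thesis by (rule countable_subset[rotated]) (auto simp: M_def W_def)
  next
    case False
    then have W: "W t = 0" if "t \<in> S" for t using that by blast
    show ?thesis
    proof (cases "\<exists>t\<in>S. b t \<noteq> 0")
      case True
      define Z where "Z = {t \<in> S. b t = 0}"
      have Z: "countable Z"
        using True countable_holomorphic_zeros[OF hol(2) S] unfolding Z_def by blast
      have "S - Z = S \<inter> b -` (- {0})" by (auto simp: Z_def)
      then have op: "open (S - Z)"
        using continuous_open_preimage[OF holomorphic_on_imp_continuous_on[OF hol(2)] S(1), of "- {0}"]
        by auto
      \<comment> \<open>Removing a countable set keeps an open connected subset of the plane
        connected, so \<open>a / b\<close>, whose derivative is the Wronskian up to a factor, is a
        single constant there.\<close>
      have conn: "connected (S - Z)"
        by (rule connected_open_diff_countable) (use S Z in auto)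
      have der: "((\<lambda>t. a t / b t) has_field_derivative 0) (at t)" if "t \<in> S - Z" for t
      proof -
        have "t \<in> S" "b t \<noteq> 0" using that by (auto simp: Z_def)
        then have "((\<lambda>t. a t / b t) has_field_derivative
            (deriv a t * b t - a t * deriv b t) / (b t * b t)) (at t)"
          by (intro DERIV_divide holomorphic_derivI[OF hol(1) S(1)] holomorphic_derivI[OF hol(2) S(1)])
        then show ?thesis using W[OF \<open>t \<in> S\<close>] by (simp add: W_def)
      qed
      have cont: "continuous_on (S - Z) (\<lambda>t. a t / b t)"
        by (rule DERIV_continuous_on[where D = "\<lambda>_. 0"]) (rule has_field_derivative_at_within[OF der])
      obtain c where c: "\<And>t. t \<in> S - Z \<Longrightarrow> a t / b t = c"
        using DERIV_zero_connected_constant[OF conn op finite.emptyI cont] der by auto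
      \<comment> \<open>Off the zeros of \<open>b\<close> the only possible \<open>s\<close> is
        \<open>c\<close>; each of the countably many zeros adds at most one more.\<close>
      have "countable (insert c (\<Union>t\<in>Z. M t))" using Z M by (auto simp: Z_def)
      then show ?thesis
      proof (rule countable_subset[rotated], safe)
        fix s t assume st: "t \<in> S" "a t = s * b t" "deriv a t = s * deriv b t" "s \<notin> (\<Union>t\<in>Z. M t)"
        then have "t \<in> S - Z" by (auto simp: M_def)
        then show "s = c" using c[of t] st by (auto simp: Z_def)
      qed
    next
      case False
      then have "deriv b t = 0" if "t \<in> S" for t
      proof -
        have "\<forall>\<^sub>F s in nhds t. b s = 0"
          using False that S by (intro eventually_nhds_in_open[of S, THEN eventually_mono]) auto
        then have "deriv b t = deriv (\<lambda>_. 0) t" by (rule deriv_cong_ev) simp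
        then show ?thesis by simp
      qed
      then have "{s. \<exists>t\<in>S. a t = s * b t \<and> deriv a t = s * deriv b t} = {}"
        using False no_common_zero by auto
      then show ?thesis by (simp only: countable_empty)
    qed
  qed
qed

text \<open>
  With \<open>a = (\<gamma> - u0) \<cdot> \<gamma>'\<close> and \<open>b = x'\<close>, the point \<open>\<gamma> t\<close> is a degenerate critical point
  for the centre \<open>u0 + (s, 0)\<close> iff \<open>a = s b\<close> and \<open>a' = s b'\<close> at \<open>t\<close>. There is no common zero of \<open>a\<close>, \<open>b\<close>,
  \<open>a'\<close>, \<open>b'\<close>, because \<open>b = b' = a = 0\<close> forces \<open>y = snd u0\<close> and hence \<open>a' = (y')\<^sup>2 \<noteq> 0\<close>.
\<close>

lemma (in curve_chart) countable_degenerate_horizontal_chart: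
  "countable {s. \<exists>t\<in>ball 0 r. critical_point f (fst u0 + s, snd u0) (\<gamma> t) \<and>
                             \<not> morse_point f (fst u0 + s, snd u0) (\<gamma> t)}"
proof -
  define X Y where "X t = fst (\<gamma> t)" and "Y t = snd (\<gamma> t)" for t
  define a where "a t = (X t - fst u0) * deriv X t + (Y t - snd u0) * deriv Y t" for t
  have hol: "X holomorphic_on ball 0 r" "Y holomorphic_on ball 0 r"
    using holX holY by (auto simp: X_def[abs_def] Y_def[abs_def])
  have hola: "a holomorphic_on ball 0 r"
    unfolding a_def by (intro holomorphic_intros hol holomorphic_deriv) auto
  have derX: "(X has_field_derivative deriv X t) (at t)"
    and derX': "(deriv X has_field_derivative deriv (deriv X) t) (at t)"
    and derY: "(Y has_field_derivative deriv Y t) (at t)"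
    and derY': "(deriv Y has_field_derivative deriv (deriv Y) t) (at t)"
    and dera: "(a has_field_derivative deriv a t) (at t)" if "t \<in> ball 0 r" for t
    using that by (auto intro!: holomorphic_derivI[of _ "ball 0 r"] holomorphic_deriv hol hola)
  have deriv_a: "deriv a t = (deriv X t)\<^sup>2 + (X t - fst u0) * deriv (deriv X) t
      + (deriv Y t)\<^sup>2 + (Y t - snd u0) * deriv (deriv Y) t" if "t \<in> ball 0 r" for t
    unfolding a_def
    by (rule DERIV_imp_deriv)
      (auto intro!: derivative_eq_intros derX[OF that] derX'[OF that] derY[OF that] derY'[OF that]
        simp: power2_eq_square algebra_simps)
  have d1: "deriv (\<lambda>t. sq_dist (fst u0 + s, snd u0) (\<gamma> t)) t = 2 * (a t - s * deriv X t)"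
    if "t \<in> ball 0 r" for s t
    unfolding deriv_sq_dist_chart[OF that]
    by (simp add: a_def algebra_simps flip: X_def Y_def)
  have d2: "(deriv ^^ 2) (\<lambda>t. sq_dist (fst u0 + s, snd u0) (\<gamma> t)) t
      = 2 * (deriv a t - s * deriv (deriv X) t)" if t: "t \<in> ball 0 r" for s t
  proof -
    have "\<forall>\<^sub>F t in nhds t. deriv (\<lambda>t. sq_dist (fst u0 + s, snd u0) (\<gamma> t)) t = 2 * (a t - s * deriv X t)"
      using t d1 by (intro eventually_nhds_in_open[of "ball 0 r", THEN eventually_mono]) auto
    then have "deriv (deriv (\<lambda>t. sq_dist (fst u0 + s, snd u0) (\<gamma> t))) t
        = deriv (\<lambda>t. 2 * (a t - s * deriv X t)) t"
      by (rule deriv_cong_ev) simp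
    also have "\<dots> = 2 * (deriv a t - s * deriv (deriv X) t)"
      by (rule DERIV_imp_deriv) (auto intro!: derivative_eq_intros derX'[OF t] dera[OF t])
    finally show ?thesis by (simp add: numeral_2_eq_2)
  qed
  have "countable {s. \<exists>t\<in>ball 0 r. a t = s * deriv X t \<and> deriv a t = s * deriv (deriv X) t}"
  proof (rule countable_common_multipliers)
    fix t assume t: "t \<in> ball 0 r" and 0: "deriv X t = 0" "deriv (deriv X) t = 0" "a t = 0"
    then have "deriv Y t \<noteq> 0" using immersion[OF t] by (simp add: X_def[abs_def] Y_def[abs_def])
    then show "deriv a t \<noteq> 0" using 0 deriv_a[OF t] by (auto simp: a_def)
  qed (auto intro!: hola holomorphic_deriv hol)
  then show ?thesis
    by (rule countable_subset[rotated])
      (auto simp: critical_point_chart_iff morse_point_chart_iff d1 d2 simp del: mem_ball)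
qed

text \<open>Every regular point lies in a chart domain. By Lindelof countably many domains cover the
  same set, and each contributes only countably many parameters.\<close>

lemma countable_degenerate_horizontal:
  "countable {s. \<exists>q. critical_point f (fst u0 + s, snd u0) q \<and> \<not> morse_point f (fst u0 + s, snd u0) q}"
proof -
  \<comment> \<open>The set depends on the domain only, so a degenerate point may be placed in any
    domain of the subcover, whatever the base point of its chart.\<close>
  define bad where "bad V = {s. \<exists>q\<in>curve f \<inter> V. critical_point f (fst u0 + s, snd u0) q \<and>
      \<not> morse_point f (fst u0 + s, snd u0) q}" for V
  define \<U> where "\<U> = {V. \<exists>p \<gamma> r coord. curve_chart f p \<gamma> r V coord}"
  have "open V" if "V \<in> \<U>" for V
    using that curve_chart.U by (auto simp: \<U>_def)
  then obtain \<V> where \<V>: "\<V> \<subseteq> \<U>" "countable \<V>" "\<Union>\<V> = \<Union>\<U>"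
    using Lindelof by meson
  have "countable (bad V)" if V: "V \<in> \<U>" for V
  proof -
    obtain p \<gamma> r coord where "curve_chart f p \<gamma> r V coord" using V unfolding \<U>_def by blast
    then interpret curve_chart f p \<gamma> r V coord .
    show ?thesis
      using countable_degenerate_horizontal_chart[of u0] unfolding bad_def image[symmetric] by simp
  qed
  then have "countable (\<Union>V\<in>\<V>. bad V)" using \<V> by blast
  moreover have "{s. \<exists>q. critical_point f (fst u0 + s, snd u0) q \<and> \<not> morse_point f (fst u0 + s, snd u0) q}
      \<subseteq> (\<Union>V\<in>\<V>. bad V)"
  proof safe
    fix s q
    assume q: "critical_point f (fst u0 + s, snd u0) q" "\<not> morse_point f (fst u0 + s, snd u0) q"
    then have "q \<in> curve_reg f" by (simp add: critical_point_def)
    then obtain \<gamma> r V coord where chart: "curve_chart f q \<gamma> r V coord" "q \<in> V"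
      by (rule curve_chart_exists)
    then have "V \<in> \<U>" unfolding \<U>_def by blast
    with chart(2) obtain V' where "q \<in> V'" "V' \<in> \<V>" using \<V>(3) by blast
    with q \<open>q \<in> curve_reg f\<close> show "s \<in> (\<Union>V\<in>\<V>. bad V)" by (auto simp: bad_def curve_reg_def)
  qed
  ultimately show ?thesis by (rule countable_subset[rotated])
qed

text \<open>The bad parameters have only countably many slopes \<open>Im z / Re z\<close>, so some
  real slope \<open>c\<close> is missed, and the open ray through \<open>Complex 1 c\<close>
  consists of good parameters.\<close>

lemma morse_deformation_exists: "\<exists>u. morse_deformation f u0 u"
proof -
  define bad where "bad = {s. \<exists>q. critical_point f (fst u0 + s, snd u0) q \<and>
      \<not> morse_point f (fst u0 + s, snd u0) q}"
  \<comment> \<open>Where \<open>Re z = 0\<close> the quotient is 0 by convention, which at worst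
    excludes the slope 0.\<close>
  have "countable ((\<lambda>z. Im z / Re z) ` bad)"
    unfolding bad_def using countable_degenerate_horizontal by blast
  then obtain c :: real where c: "c \<notin> (\<lambda>z. Im z / Re z) ` bad"
    using uncountable_UNIV_real by (metis UNIV_eq_I)
  \<comment> \<open>The real number \<open>norm s\<close> moves along the ray and depends
    continuously on the complex parameter \<open>s\<close>.\<close>
  define u where "u s = (fst u0 + of_real (norm s) * Complex 1 c, snd u0)" for s :: complex
  have "of_real (norm s) * Complex 1 c \<notin> bad" if "s \<noteq> 0" for s :: complex
  proof
    assume "of_real (norm s) * Complex 1 c \<in> bad"
    then show False using c that by (auto simp: image_iff dest: bspec)
  qed
  then have "\<forall>s\<in>ball 0 1 - {0}. \<forall>q. critical_point f (u s) q \<longrightarrow> morse_point f (u s) q"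
    unfolding u_def bad_def by blast
  moreover have "continuous_on (ball 0 1) u" unfolding u_def by (intro continuous_intros)
  moreover have "u 0 = u0" by (simp add: u_def)
  ultimately show ?thesis unfolding morse_deformation_def by (metis zero_less_one)
qed

section \<open>Counting the Morse points\<close>

lemma finite_holomorphic_zeros:
  assumes "g holomorphic_on S" "open S" "connected S" "t \<in> S" "g t \<noteq> 0" "compact K" "K \<subseteq> S"
  shows "finite {t \<in> K. g t = 0}"
proof (cases "g constant_on S")
  case True
  then have "{t \<in> K. g t = 0} = {}" using assms(4,5,7) by (auto simp: constant_on_def)
  then show ?thesis by (simp only: finite.emptyI)
next
  case False
  then show ?thesis using holomorphic_compact_finite_zeros[OF assms(1-3,6,7)] by blast
qed

text \<open>The circle winds once around the points inside and not at all around those outside; by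
  hypothesis none lies on it.\<close>

lemma sum_winding_circlepath:
  assumes "finite A" "\<And>t. t \<in> A \<Longrightarrow> norm t \<noteq> \<rho>" "0 < \<rho>"
  shows "(\<Sum>t\<in>A. winding_number (circlepath 0 \<rho>) t * k t) = (\<Sum>t\<in>{t \<in> A. norm t < \<rho>}. k t)"
proof -
  have "winding_number (circlepath 0 \<rho>) t * k t = (if norm t < \<rho> then k t else 0)" if "t \<in> A" for t
  proof (cases "norm t < \<rho>")
    case True
    then show ?thesis by (simp add: winding_number_circlepath)
  next
    case False
    then have "t \<notin> cball 0 \<rho>" using assms(2)[OF that] by auto
    then have "winding_number (circlepath 0 \<rho>) t = 0"
      using assms(3) by (intro winding_number_zero_outside[of _ "cball 0 \<rho>"]) auto
    then show ?thesis using False by simp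
  qed
  then show ?thesis using assms(1) by (simp add: sum.inter_filter)
qed

text \<open>On the circle \<open>h - g\<close> is dominated by \<open>g\<close>, so both have
  equally many zeros inside, with multiplicity. For \<open>g\<close> all multiplicity sits at 0 and
  is the order of \<open>F\<close>; for \<open>h\<close> every zero counts once.\<close>

lemma card_simple_zeros_Rouche:
  fixes g h :: "complex \<Rightarrow> complex"
  assumes hol: "g holomorphic_on ball 0 r" "h holomorphic_on ball 0 r" and \<rho>: "0 < \<rho>" "\<rho> < r"
    and g: "g has_fps_expansion F" "F \<noteq> 0"
    and g_nz: "\<And>t. t \<noteq> 0 \<Longrightarrow> norm t \<le> \<rho> \<Longrightarrow> g t \<noteq> 0"
    and less: "\<And>t. norm t = \<rho> \<Longrightarrow> norm (h t - g t) < norm (g t)"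
    and simple: "\<And>t. norm t < \<rho> \<Longrightarrow> h t = 0 \<Longrightarrow> deriv h t \<noteq> 0"
  shows "finite {t \<in> ball 0 \<rho>. h t = 0} \<and> card {t \<in> ball 0 \<rho>. h t = 0} = subdegree F"
proof -
  \<comment> \<open>Rouche's theorem is applied on an open disc with finitely many zeros; a disc
    whose closure lies in \<open>ball 0 r\<close> guarantees this.\<close>
  obtain r' where r': "\<rho> < r'" "r' < r" using dense \<rho>(2) by blast
  let ?S = "ball (0::complex) r'"
  have sub: "?S \<subseteq> ball 0 r" "cball 0 r' \<subseteq> ball 0 r" using r' by auto
  \<comment> \<open>A point of the circle, witnessing that neither \<open>g\<close> nor
    \<open>h\<close> vanishes identically.\<close>
  define t0 :: complex where "t0 = of_real \<rho>"
  have t0: "norm t0 = \<rho>" "t0 \<in> ball 0 r" "g t0 \<noteq> 0" "h t0 \<noteq> 0"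
    using \<rho> g_nz[of t0] less[of t0] by (auto simp: t0_def)
  have fin': "finite {t \<in> ?S. k t = 0}" if "k holomorphic_on ball 0 r" "k t0 \<noteq> 0" for k
  proof (rule finite_subset)
    show "finite {t \<in> cball 0 r'. k t = 0}"
      using finite_holomorphic_zeros[OF that(1) _ _ t0(2) that(2) _ sub(2)] by simp
  qed auto
  have fin: "finite {t \<in> ?S. g t = 0}" "finite {t \<in> ?S. h t = 0}"
    using fin' hol t0 by auto
  have nz: "g t \<noteq> 0" "h t \<noteq> 0" if "norm t = \<rho>" for t
    using less[OF that] by auto
  let ?c = "circlepath 0 \<rho>"
  have "(\<Sum>p\<in>{p \<in> ?S. g p + (h p - g p) = 0}. winding_number ?c p * zorder (\<lambda>p. g p + (h p - g p)) p)
      = (\<Sum>p\<in>{p \<in> ?S. g p = 0}. winding_number ?c p * zorder g p)"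
  proof (rule Rouche_theorem)
    show "\<forall>z. z \<notin> ?S \<longrightarrow> winding_number ?c z = 0"
    proof (intro allI impI)
      fix z assume "z \<notin> ?S"
      then show "winding_number ?c z = 0"
        using \<rho> r' by (intro winding_number_zero_outside[of _ "cball 0 \<rho>"]) auto
    qed
  qed (use fin hol sub \<rho> r' less in \<open>auto intro!: holomorphic_intros intro: holomorphic_on_subset\<close>)
  then have eq: "(\<Sum>p\<in>{p \<in> ?S. h p = 0}. winding_number ?c p * zorder h p)
      = (\<Sum>p\<in>{p \<in> ?S. g p = 0}. winding_number ?c p * zorder g p)"
    by simp
  have "(\<Sum>p\<in>{p \<in> ?S. h p = 0}. winding_number ?c p * zorder h p)
      = (\<Sum>t\<in>{t \<in> {p \<in> ?S. h p = 0}. norm t < \<rho>}. of_int (zorder h t))"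
    by (rule sum_winding_circlepath[OF fin(2) _ \<rho>(1)]) (use nz(2) in auto)
  also have "{t \<in> {p \<in> ?S. h p = 0}. norm t < \<rho>} = {t \<in> ball 0 \<rho>. h t = 0}" using r' by auto
  also have "(\<Sum>t\<in>{t \<in> ball 0 \<rho>. h t = 0}. of_int (zorder h t)) =
      (\<Sum>t\<in>{t \<in> ball 0 \<rho>. h t = 0}. 1 :: complex)"
  proof (rule sum.cong[OF refl])
    fix t assume t: "t \<in> {t \<in> ball 0 \<rho>. h t = 0}"
    have "zorder h t = 1"
      using t simple[of t] \<rho> by (intro zorder_zero_eqI[OF hol(2)]) auto
    then show "of_int (zorder h t) = (1 :: complex)" by simp
  qed
  also have "\<dots> = of_nat (card {t \<in> ball 0 \<rho>. h t = 0})" by simp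
  finally have lhs: "(\<Sum>p\<in>{p \<in> ?S. h p = 0}. winding_number ?c p * zorder h p)
      = of_nat (card {t \<in> ball 0 \<rho>. h t = 0})" .
  have "(\<Sum>p\<in>{p \<in> ?S. g p = 0}. winding_number ?c p * zorder g p)
      = (\<Sum>t\<in>{t \<in> {p \<in> ?S. g p = 0}. norm t < \<rho>}. of_int (zorder g t))"
    by (rule sum_winding_circlepath[OF fin(1) _ \<rho>(1)]) (use nz(1) in auto)
  also have "{t \<in> {p \<in> ?S. g p = 0}. norm t < \<rho>} = (if g 0 = 0 then {0} else {})"
  proof -
    have "t = 0" if "norm t < \<rho>" "g t = 0" for t using g_nz[of t] that by fastforce
    then show ?thesis using r' \<rho> by auto
  qed
  \<comment> \<open>If \<open>g 0 \<noteq> 0\<close>, the sum is empty and \<open>F\<close> has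
    order 0.\<close>
  also have "(\<Sum>t\<in>(if g 0 = 0 then {0} else {}). of_int (zorder g t)) = (of_nat (subdegree F) :: complex)"
  proof (cases "g 0 = 0")
    case True
    then show ?thesis using has_fps_expansion_zorder_0[OF g] by simp
  next
    case False
    then have "F $ 0 \<noteq> 0" using g(1) by (simp add: fps_nth_fps_expansion)
    then show ?thesis using False by simp
  qed
  finally have "card {t \<in> ball 0 \<rho>. h t = 0} = subdegree F" using eq lhs by (metis of_nat_eq_iff)
  moreover have "finite {t \<in> ball 0 \<rho>. h t = 0}"
    by (rule finite_subset[OF _ fin(2)]) (use r' in auto)
  ultimately show ?thesis by blast
qed

section \<open>Morse points of a deformation near the centre of a chart\<close>

context curve_chart
begin

text \<open>On the circle of radius \<open>\<rho>\<close> the derivatives for two centres differ by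
  at most a constant times the distance of the centres, so Rouche's theorem applies once
  \<open>u s\<close> is close to \<open>u0\<close>. The Morse condition makes the perturbed zeros
  simple.\<close>

lemma eventually_card_critical:
  assumes u: "morse_deformation f u0 u" and \<rho>: "0 < \<rho>" "\<rho> < r"
    and F: "deriv (\<lambda>t. sq_dist u0 (\<gamma> t)) has_fps_expansion F" "F \<noteq> 0"
    and nz: "\<And>t. t \<noteq> 0 \<Longrightarrow> norm t \<le> \<rho> \<Longrightarrow> deriv (\<lambda>t. sq_dist u0 (\<gamma> t)) t \<noteq> 0"
  shows "\<forall>\<^sub>F s in at 0. finite {t \<in> ball 0 \<rho>. deriv (\<lambda>t. sq_dist (u s) (\<gamma> t)) t = 0} \<and>
           card {t \<in> ball 0 \<rho>. deriv (\<lambda>t. sq_dist (u s) (\<gamma> t)) t = 0} = subdegree F"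
proof -
  define E where "E v = deriv (\<lambda>t. sq_dist v (\<gamma> t))" for v
  define X' Y' where "X' = deriv (\<lambda>t. fst (\<gamma> t))" and "Y' = deriv (\<lambda>t. snd (\<gamma> t))"
  have hol: "E v holomorphic_on ball 0 r" for v
    unfolding E_def by (intro holomorphic_deriv holomorphic_on_sq_dist_chart) auto
  have hol': "X' holomorphic_on ball 0 r" "Y' holomorphic_on ball 0 r"
    unfolding X'_def Y'_def by (auto intro: holomorphic_deriv holX holY)
  have sphere: "sphere 0 \<rho> \<subseteq> ball (0::complex) r" "sphere (0::complex) \<rho> \<noteq> {}" using \<rho> by auto
  have cont: "continuous_on (sphere 0 \<rho>) k" if "k holomorphic_on ball 0 r" for k
    using that sphere(1) by (meson continuous_on_subset holomorphic_on_imp_continuous_on)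
  obtain x0 where x0: "x0 \<in> sphere 0 \<rho>" "\<And>t. t \<in> sphere 0 \<rho> \<Longrightarrow> norm (E u0 x0) \<le> norm (E u0 t)"
    using continuous_attains_inf[OF compact_sphere sphere(2) continuous_on_norm[OF cont[OF hol[of u0]]]]
    by blast
  have "continuous_on (sphere 0 \<rho>) (\<lambda>t. norm (X' t) + norm (Y' t))"
    by (intro continuous_intros cont hol')
  then obtain y0 where y0: "y0 \<in> sphere 0 \<rho>"
      "\<And>t. t \<in> sphere 0 \<rho> \<Longrightarrow> norm (X' t) + norm (Y' t) \<le> norm (X' y0) + norm (Y' y0)"
    using continuous_attains_sup[OF compact_sphere sphere(2)] by blast
  \<comment> \<open>\<open>m\<close> is the minimum of \<open>norm (E u0 t)\<close> on the circle
    and \<open>M\<close> bounds the velocity of the chart there; domination holds as soon as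
    \<open>2 * dist v u0 * M < m\<close>.\<close>
  define m M where "m = norm (E u0 x0)" and "M = norm (X' y0) + norm (Y' y0)"
  have m: "m > 0" using nz[of x0] x0(1) \<rho> by (auto simp: m_def E_def)
  have diff: "norm (E v t - E u0 t) \<le> 2 * dist v u0 * M" if t: "t \<in> sphere 0 \<rho>" for v t
  proof -
    have "t \<in> ball 0 r" using t sphere by blast
    then have "E v t - E u0 t = 2 * ((fst u0 - fst v) * X' t + (snd u0 - snd v) * Y' t)"
      by (simp add: E_def X'_def Y'_def deriv_sq_dist_chart algebra_simps)
    also have "norm \<dots> \<le> 2 * (norm (fst u0 - fst v) * norm (X' t) + norm (snd u0 - snd v) * norm (Y' t))"
      by (simp add: norm_mult norm_triangle_le)
    also have "\<dots> \<le> 2 * (dist v u0 * norm (X' t) + dist v u0 * norm (Y' t))"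
      using dist_fst_le[of u0 v] dist_snd_le[of u0 v]
      by (intro mult_left_mono add_mono mult_right_mono) (auto simp: dist_norm norm_minus_commute)
    also have "\<dots> = 2 * dist v u0 * (norm (X' t) + norm (Y' t))" by (simp add: algebra_simps)
    also have "\<dots> \<le> 2 * dist v u0 * M" using y0(2)[OF t] by (intro mult_left_mono) (auto simp: M_def)
    finally show ?thesis .
  qed
  from u obtain e where e: "e > 0" "u 0 = u0" "continuous_on (ball 0 e) u"
      "\<And>s q. s \<in> ball 0 e - {0} \<Longrightarrow> critical_point f (u s) q \<Longrightarrow> morse_point f (u s) q"
    unfolding morse_deformation_def by blast
  have "isCont u 0" using e(1,3) by (simp add: continuous_on_eq_continuous_at)
  then have lim: "u \<midarrow>0\<rightarrow> u0" using e(2) by (simp add: isCont_def)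
  have "((\<lambda>s. 2 * dist (u s) u0 * M) \<longlongrightarrow> 2 * dist u0 u0 * M) (at 0)"
    by (intro tendsto_intros lim)
  then have ev1: "\<forall>\<^sub>F s in at 0. 2 * dist (u s) u0 * M < m"
    using m by (intro order_tendstoD(2)) auto
  have ev2: "\<forall>\<^sub>F s in at 0. s \<in> ball 0 e - {0}"
    using e(1) by (intro eventually_at_in_open) auto
  from ev1 ev2 show ?thesis
  proof eventually_elim
    case (elim s)
    have "finite {t \<in> ball 0 \<rho>. E (u s) t = 0} \<and> card {t \<in> ball 0 \<rho>. E (u s) t = 0} = subdegree F"
    proof (rule card_simple_zeros_Rouche[OF hol[of u0] hol \<rho> _ F(2)])
      show "E u0 has_fps_expansion F" using F(1) by (simp add: E_def)
      show "E u0 t \<noteq> 0" if "t \<noteq> 0" "norm t \<le> \<rho>" for t using nz that by (simp add: E_def)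
      show "norm (E (u s) t - E u0 t) < norm (E u0 t)" if "norm t = \<rho>" for t
        using diff[of t "u s"] x0(2)[of t] elim(1) that by (simp add: m_def)
      show "deriv (E (u s)) t \<noteq> 0" if "norm t < \<rho>" "E (u s) t = 0" for t
        using e(4)[OF elim(2), of "\<gamma> t"] that \<rho>
        by (simp add: E_def critical_point_chart_iff morse_point_chart_iff numeral_2_eq_2)
    qed
    then show ?case by (simp add: E_def)
  qed
qed

text \<open>Two discs are compared: that of radius \<open>\<rho>1\<close> captures every curve point
  of \<open>ball p r0\<close>, and that of radius \<open>\<rho>2\<close> maps into
  \<open>ball p r'\<close>. Both eventually contain \<open>N - 1\<close> critical parameters, so
  these are the same ones and the count in the ball is exact.\<close>

lemma morse_points_abut_chart:
  assumes p: "p \<in> U" and u: "morse_deformation f u0 u"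
    and G: "(\<lambda>t. sq_dist u0 (\<gamma> t)) has_fps_expansion G" "subdegree (G - fps_const (G $ 0)) = N" "N > 0"
  shows "morse_points_abut f u p (N - 1)"
proof -
  define E where "E v = deriv (\<lambda>t. sq_dist v (\<gamma> t))" for v
  define F where "F = fps_deriv G"
  have F: "E u0 has_fps_expansion F"
    unfolding E_def F_def by (intro has_fps_expansion_deriv G(1))
  have "(G - fps_const (G $ 0)) $ N \<noteq> 0" using G(2,3) by (metis nth_subdegree_nonzero subdegree_0 less_irrefl)
  moreover have "(G - fps_const (G $ 0)) $ i = 0" if "i < N" for i using G(2) that by auto
  ultimately have GN: "G $ N \<noteq> 0" "\<And>i. 0 < i \<Longrightarrow> i < N \<Longrightarrow> G $ i = 0" using G(3) by auto
  \<comment> \<open>Differentiation kills the constant term and lowers the order of the rest by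
    exactly one, the factor \<open>N\<close> being nonzero.\<close>
  have sF: "subdegree F = N - 1"
    by (rule subdegreeI) (use GN G(3) in \<open>auto simp: F_def\<close>)
  have "F $ (N - 1) \<noteq> 0" using GN G(3) by (simp add: F_def)
  then have F0: "F \<noteq> 0" by auto
  obtain \<rho>1 where \<rho>1: "0 < \<rho>1" "\<rho>1 < r" "\<And>t. t \<noteq> 0 \<Longrightarrow> norm t \<le> \<rho>1 \<Longrightarrow> E u0 t \<noteq> 0"
  proof -
    have "\<forall>\<^sub>F t in at 0. E u0 t \<noteq> 0"
      using has_laurent_expansion_nonzero_imp_eventually_nonzero[of "E u0" "fps_to_fls F"] F F0
      by (simp add: has_fps_expansion_to_laurent)
    then obtain d where d: "d > 0" "\<forall>t\<in>UNIV. t \<noteq> 0 \<and> dist t 0 < d \<longrightarrow> E u0 t \<noteq> 0"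
      unfolding eventually_at by blast
    show thesis
      by (rule that[of "min d r / 2"]) (use d r in auto)
  qed
  obtain d where d: "d > 0" "ball p d \<subseteq> U" using p U open_contains_ball by blast
  \<comment> \<open>The bound \<open>d\<close> keeps the ball inside \<open>U\<close>;
    \<open>\<rho>1\<close> bounds the coordinate difference, which is the chart parameter.\<close>
  define r0 where "r0 = min d \<rho>1"
  have r0: "r0 > 0" using d \<rho>1 by (simp add: r0_def)
  have cover: "q \<in> \<gamma> ` ball 0 \<rho>1" if "q \<in> curve f" "q \<in> ball p r0" for q
  proof -
    have "q \<in> \<gamma> ` ball 0 r" using that d(2) unfolding image by (auto simp: r0_def)
    then obtain t where t: "t \<in> ball 0 r" "q = \<gamma> t" by blast
    have "norm t = dist (coord q) (coord p)" using coord_chart[OF t(1)] t(2) by (simp add: dist_norm)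
    also have "\<dots> \<le> dist q p" using coord dist_fst_le dist_snd_le by metis
    also have "\<dots> < \<rho>1" using that(2) by (simp add: r0_def dist_commute)
    finally show ?thesis using t by auto
  qed
  show ?thesis unfolding morse_points_abut_def
  proof (intro exI[of _ r0] conjI r0 allI impI)
    fix r' assume r': "0 < r' \<and> r' \<le> r0"
    have "open (ball 0 r \<inter> \<gamma> -` ball p r')"
      by (intro continuous_open_preimage continuous_on_chart) auto
    moreover have "0 \<in> ball 0 r \<inter> \<gamma> -` ball p r'" using r r' chart_0 by auto
    ultimately obtain \<rho> where \<rho>: "\<rho> > 0" "ball 0 \<rho> \<subseteq> ball 0 r \<inter> \<gamma> -` ball p r'"
      by (meson open_contains_ball)
    define \<rho>2 where "\<rho>2 = min \<rho> \<rho>1"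
    have \<rho>2: "0 < \<rho>2" "\<rho>2 < r" "\<rho>2 \<le> \<rho>1" "\<gamma> ` ball 0 \<rho>2 \<subseteq> ball p r'"
      using \<rho> \<rho>1 by (auto simp: \<rho>2_def)
    have ev1: "\<forall>\<^sub>F s in at 0. finite {t \<in> ball 0 \<rho>1. E (u s) t = 0} \<and>
        card {t \<in> ball 0 \<rho>1. E (u s) t = 0} = subdegree F"
      unfolding E_def by (rule eventually_card_critical[OF u]) (use \<rho>1 F F0 in \<open>auto simp: E_def\<close>)
    have ev2: "\<forall>\<^sub>F s in at 0. finite {t \<in> ball 0 \<rho>2. E (u s) t = 0} \<and>
        card {t \<in> ball 0 \<rho>2. E (u s) t = 0} = subdegree F"
      unfolding E_def by (rule eventually_card_critical[OF u]) (use \<rho>2 \<rho>1 F F0 in \<open>auto simp: E_def\<close>)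
    from u obtain e where e: "e > 0"
        "\<And>s q. s \<in> ball 0 e - {0} \<Longrightarrow> critical_point f (u s) q \<Longrightarrow> morse_point f (u s) q"
      unfolding morse_deformation_def by blast
    have ev3: "\<forall>\<^sub>F s in at 0. s \<in> ball 0 e - {0}"
      using e(1) by (intro eventually_at_in_open) auto
    from ev1 ev2 ev3 show "\<forall>\<^sub>F s in at 0. finite {q \<in> ball p r'. morse_point f (u s) q} \<and>
        card {q \<in> ball p r'. morse_point f (u s) q} = N - 1"
    proof eventually_elim
      case (elim s)
      define A where "A \<rho> = \<gamma> ` {t \<in> ball 0 \<rho>. E (u s) t = 0}" for \<rho>
      have card: "finite (A \<rho>1)" "card (A \<rho>1) = N - 1" "card (A \<rho>2) = N - 1"
        using elim(1,2) sF \<rho>1(2) \<rho>2(2) unfolding A_def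
        by (auto intro!: card_image[THEN trans] inj_on_subset[OF inj_chart])
      have "A \<rho>2 \<subseteq> A \<rho>1" using \<rho>2(3) unfolding A_def by auto
      then have A: "A \<rho>2 = A \<rho>1" using card by (intro card_subset_eq) auto
      have crit: "morse_point f (u s) (\<gamma> t) \<longleftrightarrow> E (u s) t = 0" if "t \<in> ball 0 r" for t
        using critical_point_chart_iff[OF that] morse_point_chart_iff[OF that] e(2)[OF elim(3)]
        unfolding E_def by blast
      have "{q \<in> ball p r'. morse_point f (u s) q} = A \<rho>1"
      proof (intro equalityI subsetI)
        fix q assume "q \<in> {q \<in> ball p r'. morse_point f (u s) q}"
        then have q: "q \<in> ball p r'" "morse_point f (u s) q" "q \<in> curve f"
          by (auto simp: morse_point_def curve_reg_def)
        then obtain t where "t \<in> ball 0 \<rho>1" "q = \<gamma> t" using cover[of q] r' by auto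
        then show "q \<in> A \<rho>1" using crit[of t] q(2) \<rho>1(2) by (auto simp: A_def)
      next
        fix q assume "q \<in> A \<rho>1"
        then have "q \<in> A \<rho>2" by (simp only: A)
        then obtain t where t: "t \<in> ball 0 \<rho>2" "E (u s) t = 0" "q = \<gamma> t" unfolding A_def by auto
        then have "\<gamma> t \<in> ball p r'" using \<rho>2(4) by blast
        then show "q \<in> {q \<in> ball p r'. morse_point f (u s) q}"
          using t crit[of t] \<rho>2(2) by auto
      qed
      then show ?case using card by simp
    qed
  qed
qed

text \<open>The preceding count holds for all deformations alike. Uniqueness of the described number
  needs one deformation to exist, since otherwise every \<open>m\<close> would qualify
  vacuously.\<close>

lemma morse_number_chart:
  assumes "p \<in> U" "(\<lambda>t. sq_dist u0 (\<gamma> t)) has_fps_expansion G"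
    "subdegree (G - fps_const (G $ 0)) = N" "N > 0"
  shows "morse_number f u0 p = N - 1"
  unfolding morse_number_def
proof (rule the_equality)
  show "\<forall>u. morse_deformation f u0 u \<longrightarrow> morse_points_abut f u p (N - 1)"
    using morse_points_abut_chart assms by blast
  fix m assume "\<forall>u. morse_deformation f u0 u \<longrightarrow> morse_points_abut f u p m"
  moreover obtain u where u: "morse_deformation f u0 u" using morse_deformation_exists by blast
  ultimately have "morse_points_abut f u p m" by blast
  then obtain r1 where r1: "r1 > 0" "\<And>r. 0 < r \<Longrightarrow> r \<le> r1 \<Longrightarrow>
      \<forall>\<^sub>F s in at 0. finite {q \<in> ball p r. morse_point f (u s) q} \<and> card {q \<in> ball p r. morse_point f (u s) q} = m"
    unfolding morse_points_abut_def by blast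
  obtain r2 where r2: "r2 > 0" "\<And>r. 0 < r \<Longrightarrow> r \<le> r2 \<Longrightarrow>
      \<forall>\<^sub>F s in at 0. finite {q \<in> ball p r. morse_point f (u s) q} \<and> card {q \<in> ball p r. morse_point f (u s) q} = N - 1"
    using morse_points_abut_chart[OF assms(1) u assms(2-)] unfolding morse_points_abut_def by blast
  define r where "r = min r1 r2"
  have r: "r > 0" "r \<le> r1" "r \<le> r2" using r1(1) r2(1) by (auto simp: r_def)
  from r1(2)[OF r(1,2)] r2(2)[OF r(1,3)]
  have "\<forall>\<^sub>F s in at (0::complex). m = N - 1" by eventually_elim simp
  \<comment> \<open>The eventual equality does not involve the variable, and the filter at 0 is
    nontrivial.\<close>
  then show "m = N - 1" by simp
qed

end

section \<open>Intersection multiplicity as an order of vanishing\<close>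

context curve_chart
begin

section \<open>Taylor expansion along the chart, a homomorphism into the power series ring\<close>

definition expand :: "complex poly poly \<Rightarrow> complex fps" where
  "expand F = fps_expansion (\<lambda>t. eval2 F (\<gamma> t)) 0"

lemma has_fps_expansion_expand: "(\<lambda>t. eval2 F (\<gamma> t)) has_fps_expansion expand F"
  unfolding expand_def using r holomorphic_on_eval2_chart
  by (intro has_fps_expansion_fps_expansion[of "ball 0 r"]) auto

lemma expand_eqI: "(\<lambda>t. eval2 F (\<gamma> t)) has_fps_expansion \<phi> \<Longrightarrow> expand F = \<phi>"
  by (rule fps_expansion_unique_complex[OF has_fps_expansion_expand])

lemma expand_hom:
  "expand (F + G) = expand F + expand G"
  "expand (F - G) = expand F - expand G"
  "expand (F * G) = expand F * expand G"
  "expand (const2 c) = fps_const c"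
proof -
  note * = has_fps_expansion_expand[of F] has_fps_expansion_expand[of G]
  show "expand (F + G) = expand F + expand G"
    by (rule expand_eqI) (simp add: has_fps_expansion_add[OF *])
  show "expand (F - G) = expand F - expand G"
    by (rule expand_eqI) (simp add: has_fps_expansion_diff[OF *])
  show "expand (F * G) = expand F * expand G"
    by (rule expand_eqI) (simp add: has_fps_expansion_mult[OF *])
  show "expand (const2 c) = fps_const c"
    by (rule expand_eqI) simp
qed

lemma expand_1: "expand 1 = 1"
  by (rule expand_eqI) simp

lemma expand_power: "expand (F ^ n) = expand F ^ n"
  by (induction n) (simp_all add: expand_1 expand_hom)

lemma expand_nth_0: "expand F $ 0 = eval2 F p"
  using fps_nth_fps_expansion[OF has_fps_expansion_expand, of F 0] by (simp add: chart_0)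

lemma expand_nonzero: "eval2 F p \<noteq> 0 \<Longrightarrow> expand F \<noteq> 0"
  using expand_nth_0[of F] by auto

lemma expand_equation: "expand f = 0"
proof (rule expand_eqI)
  have "\<forall>\<^sub>F t in nhds 0. t \<in> ball 0 r" using r by (intro eventually_nhds_in_open) auto
  then have "\<forall>\<^sub>F t in nhds 0. eval2 f (\<gamma> t) = 0"
    by eventually_elim (use image in \<open>auto simp: curve_def\<close>)
  then show "(\<lambda>t. eval2 f (\<gamma> t)) has_fps_expansion 0" by (simp add: has_fps_expansion_0_iff)
qed

section \<open>The local parameter and division by its powers\<close>

definition uniformizer :: "complex poly poly" where
  "uniformizer = (if coord = fst then var_x - const2 (fst p) else var_y - const2 (snd p))"

lemma eval2_uniformizer: "eval2 uniformizer q = coord q - coord p"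
  using coord by (auto simp: uniformizer_def)

lemma expand_uniformizer: "expand uniformizer = fps_X"
proof (rule expand_eqI)
  have "\<forall>\<^sub>F t in nhds 0. t \<in> ball 0 r" using r by (intro eventually_nhds_in_open) auto
  then have "\<forall>\<^sub>F t in nhds 0. eval2 uniformizer (\<gamma> t) = t"
    by eventually_elim (simp add: eval2_uniformizer coord_chart)
  then show "(\<lambda>t. eval2 uniformizer (\<gamma> t)) has_fps_expansion fps_X"
    by (rule has_fps_expansion_cong[THEN iffD2, OF _ refl has_fps_expansion_fps_X])
qed

text \<open>\<open>\<sigma>\<close> stands for the coordinate that is not the chart coordinate,
  which frees later arguments from the case distinction. That \<open>B0\<close> is a unit at
  \<open>p\<close> expresses that the curve is a graph over the chart coordinate.\<close>

lemma vanishing_decomposition: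
  obtains \<sigma> A0 B0 where "eval2 \<sigma> p = 0" "f = uniformizer * A0 + \<sigma> * B0" "eval2 B0 p \<noteq> 0"
    "\<And>F. eval2 F p = 0 \<Longrightarrow> \<exists>A B. F = uniformizer * A + \<sigma> * B"
proof -
  have reg: "p \<in> curve_reg f" using regular r chart_0 by force
  then have f0: "eval2 f p = 0" by (simp add: curve_reg_def curve_def)
  obtain A B where AB: "f = (var_x - const2 (fst p)) * A + (var_y - const2 (snd p)) * B"
    "eval2 A p = eval2 (partial_x f) p" "eval2 B p = eval2 (partial_y f) p"
    using eval2_vanishing_decomposition[OF f0] by blast
  have AB0: "eval2 A p \<noteq> 0 \<or> eval2 B p \<noteq> 0" using reg AB(2,3) by (simp add: curve_reg_def)
  have *: "eval2 B0 p \<noteq> 0"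
    if "f = uniformizer * A0 + \<sigma> * B0" "eval2 \<sigma> p = 0" "eval2 A0 p \<noteq> 0 \<or> eval2 B0 p \<noteq> 0" for A0 B0 \<sigma>
  proof
    assume 0: "eval2 B0 p = 0"
    \<comment> \<open>The coefficient of \<open>t\<close> in the expansion of \<open>f\<close>,
      which is 0: if \<open>B0\<close> vanished at \<open>p\<close>, so would \<open>A0\<close>,
      against regularity.\<close>
    have "0 = (fps_X * expand A0 + expand \<sigma> * expand B0) $ 1"
      using arg_cong[OF that(1), of expand] by (simp add: expand_equation expand_hom expand_uniformizer)
    also have "\<dots> = eval2 A0 p"
      using 0 that(2) by (simp add: fps_mult_nth_1 expand_nth_0)
    finally show False using that(3) 0 by simp
  qed
  have dec: "\<exists>A B. F = (var_x - const2 (fst p)) * A + (var_y - const2 (snd p)) * B"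
    if "eval2 F p = 0" for F
    using eval2_vanishing_decomposition[OF that] by blast
  show thesis
  proof (cases "coord = fst")
    case True
    then have u: "uniformizer = var_x - const2 (fst p)" unfolding uniformizer_def by (rule if_P)
    show thesis
    proof (rule that[of "var_y - const2 (snd p)" A B])
      show "f = uniformizer * A + (var_y - const2 (snd p)) * B" using AB(1) by (simp only: u)
      then show "eval2 B p \<noteq> 0" by (rule *) (use AB0 in auto)
      show "\<exists>A B. F = uniformizer * A + (var_y - const2 (snd p)) * B" if "eval2 F p = 0" for F
        unfolding u by (rule dec[OF that])
    qed simp
  next
    case False
    then have u: "uniformizer = var_y - const2 (snd p)" unfolding uniformizer_def by (rule if_not_P)
    show thesis
    proof (rule that[of "var_x - const2 (fst p)" B A])
      show "f = uniformizer * B + (var_x - const2 (fst p)) * A"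
        using AB(1) by (simp only: u add.commute)
      then show "eval2 A p \<noteq> 0" by (rule *) (use AB0 in auto)
      show "\<exists>A B. F = uniformizer * A + (var_x - const2 (fst p)) * B" if "eval2 F p = 0" for F
        unfolding u using dec[OF that] by (metis add.commute)
    qed simp
  qed
qed

text \<open>
  Over the local ring, \<open>f\<close> and the uniformizer generate the maximal ideal; \<open>e\<close> is the cleared
  denominator.
\<close>

lemma divide_by_uniformizer:
  assumes "eval2 F p = 0"
  obtains e a b where "eval2 e p \<noteq> 0" "e * F = a * f + uniformizer * b"
proof -
  obtain \<sigma> A0 B0 where \<sigma>: "f = uniformizer * A0 + \<sigma> * B0" "eval2 B0 p \<noteq> 0"
    "\<And>F. eval2 F p = 0 \<Longrightarrow> \<exists>A B. F = uniformizer * A + \<sigma> * B"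
    using vanishing_decomposition by metis
  obtain A B where F: "F = uniformizer * A + \<sigma> * B" using \<sigma>(3)[OF assms] by blast
  \<comment> \<open>Multiplication by \<open>B0\<close> allows \<open>\<sigma> * B0\<close> to be
    replaced by \<open>f - uniformizer * A0\<close>.\<close>
  have "B0 * F = B * (uniformizer * A0 + \<sigma> * B0) + uniformizer * (B0 * A - B * A0)"
    unfolding F by (simp add: algebra_simps)
  then have "B0 * F = B * f + uniformizer * (B0 * A - B * A0)" by (simp only: \<sigma>(1)[symmetric])
  with \<sigma>(2) that show thesis by blast
qed

text \<open>By induction: the value at \<open>p\<close> of the remaining cofactor is coefficient
  \<open>n\<close> of \<open>expand e * expand F\<close>, which is zero, so one more factor splits
  off.\<close>

lemma divide_by_uniformizer_power:
  assumes "\<And>i. i < n \<Longrightarrow> expand F $ i = 0"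
  shows "\<exists>e a b. eval2 e p \<noteq> 0 \<and> e * F = a * f + uniformizer ^ n * b"
  using assms
proof (induction n)
  case 0
  show ?case by (rule exI[of _ 1], rule exI[of _ 0], rule exI[of _ F]) simp
next
  case (Suc n)
  then obtain e a b where e: "eval2 e p \<noteq> 0" "e * F = a * f + uniformizer ^ n * b" by auto
  have "expand e * expand F = fps_X ^ n * expand b"
    using arg_cong[OF e(2), of expand]
    by (simp add: expand_hom expand_equation expand_power expand_uniformizer)
  then have "eval2 b p = (expand e * expand F) $ n" by (simp add: fps_X_power_mult_nth expand_nth_0)
  also have "\<dots> = 0" unfolding fps_mult_nth by (rule sum.neutral) (use Suc.prems in auto)
  finally obtain e' a' b' where e': "eval2 e' p \<noteq> 0" "e' * b = a' * f + uniformizer * b'"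
    using divide_by_uniformizer by blast
  have "(e' * e) * F = e' * (a * f + uniformizer ^ n * b)" using e(2) by (simp add: mult.assoc)
  also have "\<dots> = e' * a * f + uniformizer ^ n * (e' * b)" by (simp add: algebra_simps)
  also have "\<dots> = (e' * a + uniformizer ^ n * a') * f + uniformizer ^ Suc n * b'"
    unfolding e'(2) by (simp add: algebra_simps)
  finally show ?case using e(1) e'(1) by (metis eval2_simps(3) mult_eq_0_iff)
qed

text \<open>The restriction to the curve; it is unspecified outside the local ring.\<close>

definition germ :: "complex poly poly fract \<Rightarrow> complex fps" where
  "germ h = (THE \<phi>. \<exists>a b. h = Fract a b \<and> eval2 b p \<noteq> 0 \<and> \<phi> * expand b = expand a)"

text \<open>Cross-multiplication makes the quotient series independent of the fraction, since the
  power series form a domain in which the expanded denominators are nonzero.\<close>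

lemma germ_eqI:
  assumes "h = Fract a b" "eval2 b p \<noteq> 0" "\<phi> * expand b = expand a"
  shows "germ h = \<phi>"
  unfolding germ_def
proof (rule the_equality)
  show "\<exists>a b. h = Fract a b \<and> eval2 b p \<noteq> 0 \<and> \<phi> * expand b = expand a" using assms by blast
  fix \<psi> assume "\<exists>a b. h = Fract a b \<and> eval2 b p \<noteq> 0 \<and> \<psi> * expand b = expand a"
  then obtain a' b' where 1: "h = Fract a' b'" "eval2 b' p \<noteq> 0" "\<psi> * expand b' = expand a'" by blast
  have "b \<noteq> 0" "b' \<noteq> 0" using assms(2) 1(2) by auto
  then have "a * b' = a' * b" using assms(1) 1(1) eq_fract(1) by metis
  then have "expand a * expand b' = expand a' * expand b" using expand_hom(3) by metis
  then have "\<psi> * (expand b * expand b') = \<phi> * (expand b * expand b')"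
    using assms(3) 1(3) by (metis mult.assoc mult.commute)
  then show "\<psi> = \<phi>" using expand_nonzero assms(2) 1(2) by simp
qed

text \<open>A denominator that is nonzero at \<open>p\<close> expands to a series with nonzero
  constant term, hence to a unit.\<close>

lemma germ_Fract:
  assumes "eval2 b p \<noteq> 0"
  shows "germ (Fract a b) * expand b = expand a"
proof -
  have *: "expand a * inverse (expand b) * expand b = expand a"
    using assms by (simp add: mult.assoc inverse_mult_eq_1 expand_nth_0)
  show ?thesis using germ_eqI[OF refl assms *] * by simp
qed

lemma germ_to_fract: "germ (to_fract F) = expand F"
  by (rule germ_eqI[of _ F 1]) (simp_all add: to_fract_def expand_1)

lemma local_ringI: "eval2 b p \<noteq> 0 \<Longrightarrow> Fract a b \<in> local_ring p"
  unfolding local_ring_def by blast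

lemma to_fract_local_ring: "to_fract F \<in> local_ring p"
  using local_ringI[of 1 F] by (simp add: to_fract_def)

section \<open>Ring operations in the local ring and on germs\<close>

lemma local_ring_add_germ:
  assumes "h \<in> local_ring p" "k \<in> local_ring p"
  shows "h + k \<in> local_ring p \<and> germ (h + k) = germ h + germ k"
proof -
  obtain a b c d where hk: "h = Fract a b" "eval2 b p \<noteq> 0" "k = Fract c d" "eval2 d p \<noteq> 0"
    using assms unfolding local_ring_def by blast
  then have "b \<noteq> 0" "d \<noteq> 0" by auto
  then have eq: "h + k = Fract (a * d + c * b) (b * d)" and nz: "eval2 (b * d) p \<noteq> 0"
    using hk by auto
  have "(germ h + germ k) * expand (b * d) =
      germ h * expand b * expand d + germ k * expand d * expand b"
    by (simp add: expand_hom algebra_simps)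
  also have "\<dots> = expand (a * d + c * b)"
    using hk germ_Fract by (simp add: expand_hom)
  finally show ?thesis using germ_eqI[OF eq nz] local_ringI[OF nz] eq by simp
qed

lemma local_ring_mult_germ:
  assumes "h \<in> local_ring p" "k \<in> local_ring p"
  shows "h * k \<in> local_ring p \<and> germ (h * k) = germ h * germ k"
proof -
  obtain a b c d where hk: "h = Fract a b" "eval2 b p \<noteq> 0" "k = Fract c d" "eval2 d p \<noteq> 0"
    using assms unfolding local_ring_def by blast
  then have eq: "h * k = Fract (a * c) (b * d)" and nz: "eval2 (b * d) p \<noteq> 0"
    by auto
  have "(germ h * germ k) * expand (b * d) = (germ h * expand b) * (germ k * expand d)"
    by (simp add: expand_hom algebra_simps)
  also have "\<dots> = expand (a * c)"
    using hk germ_Fract by (simp add: expand_hom)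
  finally show ?thesis using germ_eqI[OF eq nz] local_ringI[OF nz] eq by simp
qed

lemma local_ring_diff_germ:
  assumes "h \<in> local_ring p" "k \<in> local_ring p"
  shows "h - k \<in> local_ring p \<and> germ (h - k) = germ h - germ k"
proof -
  have "const2 (- 1) = - 1" by (simp add: const2_def one_pCons)
  then have m: "- k = to_fract (const2 (- 1)) * k" by simp
  have "- k \<in> local_ring p \<and> germ (- k) = - germ k"
    unfolding m using local_ring_mult_germ[OF to_fract_local_ring[of "const2 (- 1)"] assms(2)]
    by (simp add: germ_to_fract expand_hom flip: fps_const_neg)
  then show ?thesis using local_ring_add_germ[OF assms(1), of "- k"] by simp
qed

lemma local_ring_sum_germ:
  assumes "finite B" "B \<subseteq> local_ring p"
  shows "(\<Sum>b\<in>B. to_fract (const2 (c b)) * b) \<in> local_ring p \<and>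
    germ (\<Sum>b\<in>B. to_fract (const2 (c b)) * b) = (\<Sum>b\<in>B. fps_const (c b) * germ b)"
  using assms
proof (induction B)
  case empty
  show ?case using to_fract_local_ring[of 0] germ_to_fract[of 0] expand_hom(4)[of 0]
    by (simp add: const2_def)
next
  case (insert b B)
  then show ?case
    using local_ring_add_germ[OF conjunct1[OF local_ring_mult_germ[OF to_fract_local_ring[of "const2 (c b)"]]]]
      local_ring_mult_germ[OF to_fract_local_ring[of "const2 (c b)"]]
    by (simp add: germ_to_fract expand_hom)
qed

section \<open>The ideal of \<open>f\<close> and \<open>g\<close> in the local ring and its
  codimension\<close>

lemma germ_local_ideal_nth:
  assumes "h \<in> local_ideal p f g" "\<And>i. i < N \<Longrightarrow> expand g $ i = 0" "i < N"
  shows "germ h $ i = 0"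
proof -
  obtain a b where ab: "h = a * to_fract f + b * to_fract g" "a \<in> local_ring p" "b \<in> local_ring p"
    using assms(1) unfolding local_ideal_def by blast
  \<comment> \<open>The multiple of \<open>f\<close> disappears because \<open>f\<close> expands to
    0.\<close>
  then have "germ h = germ b * expand g"
    using local_ring_add_germ local_ring_mult_germ to_fract_local_ring
    by (simp add: germ_to_fract expand_equation)
  also have "\<dots> $ i = 0" unfolding fps_mult_nth by (rule sum.neutral) (use assms(2,3) in auto)
  finally show ?thesis .
qed

text \<open>Modulo \<open>f\<close> and up to units at \<open>p\<close>, \<open>g\<close> is the
  power \<open>uniformizer ^ N\<close> with \<open>N\<close> its order, and the numerator of
  \<open>h\<close> is a multiple of that power.\<close>

lemma local_idealI:
  assumes h: "h \<in> local_ring p" and g: "expand g \<noteq> 0"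
    and van: "\<And>i. i < subdegree (expand g) \<Longrightarrow> germ h $ i = 0"
  shows "h \<in> local_ideal p f g"
proof -
  define N where "N = subdegree (expand g)"
  have "expand g $ i = 0" if "i < N" for i using that unfolding N_def by (rule nth_less_subdegree_zero)
  then obtain e a b where e: "eval2 e p \<noteq> 0" "e * g = a * f + uniformizer ^ N * b"
    using divide_by_uniformizer_power by blast
  have "expand e * expand g = fps_X ^ N * expand b"
    using arg_cong[OF e(2), of expand]
    by (simp add: expand_hom expand_equation expand_power expand_uniformizer)
  \<comment> \<open>Coefficient \<open>N\<close> of the product is the product of the leading
    coefficients, so \<open>b\<close> is a unit at \<open>p\<close>.\<close>
  then have "eval2 b p = (expand e * expand g) $ N" by (simp add: fps_X_power_mult_nth expand_nth_0)
  also have "\<dots> = expand e $ 0 * expand g $ N"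
    unfolding N_def by (rule nth_subdegree_mult_right)
  also have "\<dots> \<noteq> 0" using e(1) g by (simp add: expand_nth_0 N_def)
  finally have b: "eval2 b p \<noteq> 0" .
  obtain n d where nd: "h = Fract n d" "eval2 d p \<noteq> 0" using h unfolding local_ring_def by blast
  have "expand n $ i = 0" if "i < N" for i
    unfolding germ_Fract[OF nd(2), of n, symmetric] fps_mult_nth
    by (rule sum.neutral) (use van that nd(1) N_def in auto)
  then obtain e' a' b' where e': "eval2 e' p \<noteq> 0" "e' * n = a' * f + uniformizer ^ N * b'"
    using divide_by_uniformizer_power by blast
  \<comment> \<open>\<open>d\<close> is the denominator of \<open>h\<close>; \<open>b\<close> and
    \<open>e'\<close> are the units that bring its numerator into the form of a combination of
    \<open>f\<close> and \<open>g\<close>.\<close>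
  define D where "D = b * e' * d"
  have D: "eval2 D p \<noteq> 0" using b e'(1) nd(2) by (simp add: D_def)
  have "b * e' * n = b * (a' * f + uniformizer ^ N * b')" using e'(2) by (simp add: mult.assoc)
  also have "\<dots> = b * a' * f + b' * (uniformizer ^ N * b)" by (simp add: algebra_simps)
  also have "uniformizer ^ N * b = e * g - a * f" using e(2) by simp
  also have "b * a' * f + b' * (e * g - a * f) = (b * a' - b' * a) * f + (b' * e) * g"
    by (simp add: algebra_simps)
  finally have eq: "b * e' * n = (b * a' - b' * a) * f + (b' * e) * g" .
  have "b \<noteq> 0" "e' \<noteq> 0" "d \<noteq> 0" using b e'(1) nd(2) by auto
  then have "h = Fract (b * e' * n) D"
    unfolding nd(1) by (simp add: D_def eq_fract)
  also have "\<dots> = to_fract (b * e' * n) / to_fract D" by (rule Fract_conv_to_fract)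
  also have "\<dots> = Fract (b * a' - b' * a) D * to_fract f + Fract (b' * e) D * to_fract g"
    unfolding eq by (simp add: Fract_conv_to_fract add_divide_distrib)
  finally show ?thesis unfolding local_ideal_def using local_ringI[OF D] by blast
qed

text \<open>Germs of ideal elements have no terms below degree \<open>N\<close>, so the truncated
  germs of \<open>B\<close> span the \<open>N\<close> independent powers of \<open>t\<close> below
  \<open>N\<close>. With \<open>N\<close> only a lower bound for the order, the case
  \<open>expand g = 0\<close> is included.\<close>

lemma card_local_quotient_basis_ge:
  assumes B: "local_quotient_basis p f g B" and van: "\<And>i. i < N \<Longrightarrow> expand g $ i = 0"
  shows "N \<le> card B"
proof -
  \<comment> \<open>Complex scalars act through constant series, which makes the bound on
    independent sets in a span available.\<close>
  interpret vs: vector_space "\<lambda>c F :: complex fps. fps_const c * F"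
    by unfold_locales (simp_all add: algebra_simps flip: fps_const_add fps_const_mult)
  have fin: "finite B" "B \<subseteq> local_ring p" using B by (auto simp: local_quotient_basis_def)
  define S where "S = (\<lambda>i. fps_X ^ i :: complex fps) ` {..<N}"
  have "inj_on (\<lambda>i. fps_X ^ i :: complex fps) {..<N}"
    by (rule inj_onI) (metis fps_X_power_subdegree)
  then have cS: "card S = N" by (simp add: S_def card_image)
  have ind: "\<not> vs.dependent S"
  proof
    assume "vs.dependent S"
    then obtain T c v where T: "finite T" "T \<subseteq> S" "(\<Sum>v\<in>T. fps_const (c v) * v) = 0" "v \<in> T" "c v \<noteq> 0"
      unfolding vs.dependent_explicit by blast
    obtain j where j: "v = fps_X ^ j" using T(2,4) by (auto simp: S_def)
    have "0 = (\<Sum>v\<in>T. fps_const (c v) * v) $ j" using T(3) by simp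
    also have "\<dots> = (\<Sum>w\<in>T. if w = v then c v else 0)"
      unfolding fps_sum_nth
    proof (rule sum.cong[OF refl])
      fix w assume "w \<in> T"
      then obtain i where "w = fps_X ^ i" using T(2) by (auto simp: S_def)
      then show "(fps_const (c w) * w) $ j = (if w = v then c v else 0)"
        using j by auto
    qed
    also have "\<dots> = c v" using T(1,4) by simp
    finally show False using T(5) by simp
  qed
  have "S \<subseteq> vs.span ((\<lambda>b. fps_cutoff N (germ b)) ` B)"
  proof
    fix v assume "v \<in> S"
    then obtain i where i: "i < N" "v = fps_X ^ i" by (auto simp: S_def)
    define h where "h = to_fract (uniformizer ^ i)"
    have h: "h \<in> local_ring p" "germ h = fps_X ^ i"
      by (simp_all add: h_def to_fract_local_ring germ_to_fract expand_power expand_uniformizer)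
    then obtain c where c: "h - (\<Sum>b\<in>B. to_fract (const2 (c b)) * b) \<in> local_ideal p f g"
      using B unfolding local_quotient_basis_def by blast
    note sum = local_ring_sum_germ[OF fin, of c]
    have coeff: "germ h $ k - (\<Sum>b\<in>B. fps_const (c b) * germ b) $ k = 0" if "k < N" for k
      using germ_local_ideal_nth[OF c van that] local_ring_diff_germ[OF h(1) conjunct1[OF sum]] sum
      by simp
    have "v = (\<Sum>b\<in>B. fps_const (c b) * fps_cutoff N (germ b))"
    proof (rule fps_ext)
      fix k
      show "v $ k = (\<Sum>b\<in>B. fps_const (c b) * fps_cutoff N (germ b)) $ k"
        using coeff[of k] i h(2) by (cases "k < N") (auto simp: fps_sum_nth)
    qed
    also have "\<dots> \<in> vs.span ((\<lambda>b. fps_cutoff N (germ b)) ` B)"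
      by (intro vs.span_sum vs.span_scale vs.span_base) auto
    finally show "v \<in> vs.span ((\<lambda>b. fps_cutoff N (germ b)) ` B)" .
  qed
  then have "card S \<le> card ((\<lambda>b. fps_cutoff N (germ b)) ` B)"
    using vs.independent_span_bound[OF _ ind] fin(1) by blast
  also have "\<dots> \<le> card B" using fin(1) by (rule card_image_le)
  finally show ?thesis using cS by simp
qed

text \<open>A combination of these powers differs from \<open>h\<close> by an ideal element iff its
  coefficients are the Taylor coefficients of \<open>germ h\<close> below the order of
  \<open>expand g\<close>; this gives existence and uniqueness at once.\<close>

lemma local_quotient_basis_uniformizer:
  assumes g: "expand g \<noteq> 0"
  shows "local_quotient_basis p f g ((\<lambda>i. to_fract (uniformizer ^ i)) ` {..<subdegree (expand g)})"
    (is "local_quotient_basis p f g (?v ` {..<?N})")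
  unfolding local_quotient_basis_def
proof (intro conjI ballI)
  let ?B = "?v ` {..<?N}"
  have germ_v: "germ (?v i) = fps_X ^ i" for i
    by (simp add: germ_to_fract expand_power expand_uniformizer)
  \<comment> \<open>Different powers have expansions of different order.\<close>
  have inj: "inj ?v" by (rule injI) (metis germ_v fps_X_power_subdegree)
  show B: "finite ?B" "?B \<subseteq> local_ring p" using to_fract_local_ring by auto
  fix h assume h: "h \<in> local_ring p"
  have iff: "h - (\<Sum>b\<in>?B. to_fract (const2 (c b)) * b) \<in> local_ideal p f g \<longleftrightarrow>
      (\<forall>i<?N. c (?v i) = germ h $ i)" (is "?k \<in> _ \<longleftrightarrow> _") for c
  proof -
    note sum = local_ring_sum_germ[OF B, of c]
    note k = local_ring_diff_germ[OF h conjunct1[OF sum]]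
    have nth: "germ ?k $ i = germ h $ i - c (?v i)" if "i < ?N" for i
    proof -
      have "(\<Sum>b\<in>?B. fps_const (c b) * germ b) $ i = (\<Sum>j<?N. c (?v j) * (fps_X ^ j) $ i)"
        by (subst sum.reindex[OF inj_on_subset[OF inj]]) (auto simp: fps_sum_nth germ_v)
      also have "\<dots> = (\<Sum>j<?N. if j = i then c (?v i) else 0)" by (rule sum.cong) auto
      also have "\<dots> = c (?v i)" using that by simp
      finally show ?thesis using k sum by simp
    qed
    show ?thesis
    proof
      assume k0: "?k \<in> local_ideal p f g"
      have "germ ?k $ i = 0" if i: "i < ?N" for i
        by (rule germ_local_ideal_nth[OF k0 nth_less_subdegree_zero i])
      then show "\<forall>i<?N. c (?v i) = germ h $ i" by (simp add: nth)
    next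
      assume c: "\<forall>i<?N. c (?v i) = germ h $ i"
      show "?k \<in> local_ideal p f g"
        by (rule local_idealI[OF conjunct1[OF k] g]) (simp add: nth c)
    qed
  qed
  define c where "c b = (if b \<in> ?B then germ h $ (inv ?v b) else 0)" for b
  show "\<exists>!c. (\<forall>b. b \<notin> ?B \<longrightarrow> c b = 0) \<and>
      h - (\<Sum>b\<in>?B. to_fract (const2 (c b)) * b) \<in> local_ideal p f g"
    unfolding iff
  proof (rule ex1I[of _ c])
    show "(\<forall>b. b \<notin> ?B \<longrightarrow> c b = 0) \<and> (\<forall>i<?N. c (?v i) = germ h $ i)"
      using inv_f_f[OF inj] by (auto simp: c_def)
    show "d = c" if "(\<forall>b. b \<notin> ?B \<longrightarrow> d b = 0) \<and> (\<forall>i<?N. d (?v i) = germ h $ i)" for d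
    proof
      show "d b = c b" for b
        using that inv_f_f[OF inj] by (cases "b \<in> ?B") (auto simp: c_def)
    qed
  qed
qed

text \<open>Finiteness provides a basis, because the infimum over the empty set is \<infinity>. The
  powers of the uniformizer then bound the infimum from above, and the spanning argument bounds it
  from below.\<close>

lemma intersection_multiplicity_chart:
  assumes "intersection_multiplicity p f g \<noteq> \<infinity>"
  shows "expand g \<noteq> 0" "intersection_multiplicity p f g = enat (subdegree (expand g))"
proof -
  have "\<exists>B. local_quotient_basis p f g B"
  proof (rule ccontr)
    assume "\<nexists>B. local_quotient_basis p f g B"
    then have "{B. local_quotient_basis p f g B} = {}" by blast
    then show False using assms by (simp add: intersection_multiplicity_def top_enat_def)
  qed
  then obtain B where B: "local_quotient_basis p f g B" by blast
  show g: "expand g \<noteq> 0"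
  proof
    assume "expand g = 0"
    \<comment> \<open>For a zero expansion the lower bound holds with every \<open>N\<close>, in
      particular with one more than the size of \<open>B\<close>.\<close>
    then have "Suc (card B) \<le> card B" by (intro card_local_quotient_basis_ge[OF B]) simp
    then show False by simp
  qed
  let ?N = "subdegree (expand g)" and ?v = "\<lambda>i. to_fract (uniformizer ^ i)"
  have card: "enat (card (?v ` {..<?N})) \<le> enat ?N" using card_image_le[of "{..<?N}" ?v] by simp
  have basis: "?v ` {..<?N} \<in> {B. local_quotient_basis p f g B}"
    using local_quotient_basis_uniformizer[OF g] by (rule CollectI)
  have "intersection_multiplicity p f g \<le> enat ?N"
    unfolding intersection_multiplicity_def
    using INF_lower2[where f = "\<lambda>B. enat (card B)", OF basis card] .
  moreover have "enat ?N \<le> intersection_multiplicity p f g"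
    unfolding intersection_multiplicity_def
  proof (rule INF_greatest)
    fix B assume "B \<in> {B. local_quotient_basis p f g B}"
    then have B: "local_quotient_basis p f g B" by (rule CollectD)
    have "?N \<le> card B" by (rule card_local_quotient_basis_ge[OF B nth_less_subdegree_zero])
    then show "enat ?N \<le> enat (card B)" by simp
  qed
  ultimately show "intersection_multiplicity p f g = enat ?N" by (rule antisym)
qed

end

theorem theorem5p8:
  fixes f :: "complex poly poly" and u0 p :: "complex \<times> complex"
  assumes "reduced_curve_equation f"
    and "u0 \<in> ED_discriminant_reg f"
    and "critical_point f u0 p"
    and "intersection_multiplicity p f (sq_dist_poly u0 - const2 (sq_dist u0 p)) \<noteq> \<infinity>"
  shows "enat (morse_number f u0 p) =
           intersection_multiplicity p f (sq_dist_poly u0 - const2 (sq_dist u0 p)) - 1"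
proof -
  have "p \<in> curve_reg f" using assms(3) by (simp add: critical_point_def)
  then obtain \<gamma> r U coord where "curve_chart f p \<gamma> r U coord" and p: "p \<in> U"
    by (rule curve_chart_exists)
  then interpret curve_chart f p \<gamma> r U coord by simp
  let ?g = "sq_dist_poly u0 - const2 (sq_dist u0 p)"
  define G where "G = expand (sq_dist_poly u0)"
  have G: "(\<lambda>t. sq_dist u0 (\<gamma> t)) has_fps_expansion G"
    using has_fps_expansion_expand[of "sq_dist_poly u0"] by (simp add: G_def)
  \<comment> \<open>The value of the distance function at \<open>p\<close> is the constant Taylor
    coefficient, so the curve equation expands to the series without it.\<close>
  have g: "expand ?g = G - fps_const (G $ 0)"
    by (simp add: G_def expand_hom expand_nth_0)
  define N where "N = subdegree (expand ?g)"
  note mult = intersection_multiplicity_chart[OF assms(4)]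
  have "expand ?g $ 0 = 0" by (simp add: g)
  \<comment> \<open>A nonzero series without constant term has positive order, so
    \<open>N - 1\<close> loses nothing to truncated subtraction.\<close>
  then have "N > 0" using mult(1) unfolding N_def by (metis gr0I nth_subdegree_nonzero)
  then have "morse_number f u0 p = N - 1"
    using morse_number_chart[OF p G, of N] g by (simp add: N_def)
  then show ?thesis using mult(2) \<open>N > 0\<close> by (simp add: N_def one_enat_def)
qed

end
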